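(* Consider the Abel equation $\frac{dx}{dt}=(a_0+a_1t^j+a_2t^k)x^3+(b_0+b_1t^j+b_2t^k)x^2$ with $j,k\in\mathbb{N}$, $0<j<k$, and $a_0,a_1,a_2,b_0,b_1,b_2$ arbitrary real numbers. (a) It has a center at $x=0$ if and only if $a_0+a_1/(j+1)+a_2/(k+1)=b_0+b_1/(j+1)+b_2/(k+1)=a_2b_1-a_1b_2=0$. (b) Suppose it does not have a center at $x=0$, and consider the following three conditions: 1) either $a_2b_1-a_1b_2=0$ or $\frac{a_2b_0-a_0b_2}{a_2b_1-a_1b_2}\notin(-1,0)$; 2) either $a_1b_2-a_2b_1=0$ or $\frac{a_1b_0-a_0b_1}{a_1b_2-a_2b_1}\notin(-1,0)$; 3) either $a_0b_2-a_2b_0=0$ or $\frac{a_0b_1-a_1b_0}{a_0b_2-a_2b_0}\notin(-1,0)$. If one of these three conditions is satisfied, then the equation has at most one non-zero periodic orbit, and when this periodic orbit exists, it is hyperbolic. (c) There are equations of this form having at least two non-zero hyperbolic periodic orbits.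
   Context: A periodic orbit of an equation $dx/dt=A(t)x^3+B(t)x^2$ on the strip $\{(t,x): t\in[0,1], x\in\mathbb{R}\}$ is a solution with $x(0)=x(1)$; $x=0$ is always one. A periodic orbit is hyperbolic if the Poincaré map between $t=0$ and $t=1$ has derivative different from 1 at its initial condition. The equation has a center at a periodic orbit if all orbits in a neighborhood of it are periodic. *)

theory Defs
  imports "HOL-Analysis.Analysis"
begin

definition abel_sol :: "(real \<Rightarrow> real) \<Rightarrow> (real \<Rightarrow> real) \<Rightarrow> real \<Rightarrow> (real \<Rightarrow> real) \<Rightarrow> bool" where
  "abel_sol A B x0 u \<longleftrightarrow> u 0 = x0 \<and>
     (\<forall>t\<in>{0..1}. (u has_real_derivative (A t * (u t)^3 + B t * (u t)^2)) (at t within {0..1}))"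

definition abel_dom :: "(real \<Rightarrow> real) \<Rightarrow> (real \<Rightarrow> real) \<Rightarrow> real set" where
  "abel_dom A B = {x0. \<exists>u. abel_sol A B x0 u}"

text \<open>Poincare map between t=0 and t=1 (solutions are unique).\<close>
definition poincare :: "(real \<Rightarrow> real) \<Rightarrow> (real \<Rightarrow> real) \<Rightarrow> real \<Rightarrow> real" where
  "poincare A B x0 = (THE y. \<exists>u. abel_sol A B x0 u \<and> u 1 = y)"

definition periodic_orbit :: "(real \<Rightarrow> real) \<Rightarrow> (real \<Rightarrow> real) \<Rightarrow> real \<Rightarrow> bool" where
  "periodic_orbit A B x0 \<longleftrightarrow> (\<exists>u. abel_sol A B x0 u \<and> u 1 = x0)"

definition hyperbolic_orbit :: "(real \<Rightarrow> real) \<Rightarrow> (real \<Rightarrow> real) \<Rightarrow> real \<Rightarrow> bool" where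
  "hyperbolic_orbit A B x0 \<longleftrightarrow> periodic_orbit A B x0 \<and>
     (\<exists>d. (poincare A B has_real_derivative d) (at x0 within abel_dom A B) \<and> d \<noteq> 1)"

definition has_center :: "(real \<Rightarrow> real) \<Rightarrow> (real \<Rightarrow> real) \<Rightarrow> real \<Rightarrow> bool" where
  "has_center A B x0 \<longleftrightarrow> periodic_orbit A B x0 \<and>
     (\<exists>\<epsilon>>0. \<forall>y. \<bar>y - x0\<bar> < \<epsilon> \<longrightarrow> periodic_orbit A B y)"

definition trin :: "nat \<Rightarrow> nat \<Rightarrow> real \<Rightarrow> real \<Rightarrow> real \<Rightarrow> real \<Rightarrow> real" where
  "trin j k c0 c1 c2 t = c0 + c1 * t ^ j + c2 * t ^ k"

end

theory Submission
  imports Defs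
begin

text \<open>
  Along a solution \<open>u\<close> without zeros, \<open>(1/u)' = - B - A u\<close>, so everything is done with reciprocals.
  Iterating this equation once gives, with \<open>Bt\<close> the primitive of \<open>B\<close>,
  \<open>1/x - 1/P(x) = \<integral>B + x \<integral>A + x\<^sup>2 \<integral>A Bt + O(x\<^sup>3)\<close> for the Poincare map \<open>P\<close>.
  A center forces the three integrals to vanish, and for zero-mean trinomials the third one is a
  nonzero multiple of \<open>a\<^sub>2 b\<^sub>1 - a\<^sub>1 b\<^sub>2\<close>; conversely the three conditions make \<open>A\<close> and \<open>B\<close> proportional and
  the equation separable. If the quadratic has two well separated simple roots close to \<open>0\<close>,
  the intermediate value theorem gives two periodic orbits.

  In part (b), unless \<open>A\<close> and \<open>B\<close> are proportional, each of the three conditions yields a combination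
  of \<open>A\<close> and \<open>B\<close>, eliminating one of the monomials, that has no zero in \<open>(0,1)\<close>.
  If \<open>C = A + \<beta> B\<close> has no
  zero and \<open>z = 1/u - \<beta>\<close>, then \<open>z + \<beta> ln |z|\<close> has derivative \<open>- B - C/z\<close>, so by Rolle's theorem two
  periodic solutions would meet. Adding suitable derivatives of logarithms to the exponent
  \<open>3 A u\<^sup>2 + 2 B u\<close> of the derivative of \<open>P\<close> turns it into \<open>u C/z\<close>, which proves hyperbolicity.
\<close>

subsection \<open>Solutions and the Poincare map\<close>

lemma rolle_within:
  fixes f f' :: "real \<Rightarrow> real"
  assumes f: "\<And>t. t \<in> {a..b} \<Longrightarrow> (f has_real_derivative f' t) (at t within {a..b})"
    and st: "a \<le> s" "s < t" "t \<le> b" "f s = f t"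
  obtains z where "s < z" "z < t" "f' z = 0"
proof -
  have "continuous_on {a..b} f"
    using f by (rule DERIV_continuous_on)
  then have "continuous_on {s..t} f"
    by (rule continuous_on_subset) (use st in auto)
  moreover have "DERIV f x :> f' x" if "s < x" "x < t" for x
    using f[of x] that st by (simp add: at_within_Icc_at)
  ultimately obtain z where z: "s < z" "z < t" "f' z = 0"
    using Rolle_deriv[of s t f "\<lambda>x v. f' x * v"] st
    by (metis has_field_derivative_def mult_cancel_left2 mult_eq_0_iff)
  then show ?thesis using that by blast
qed

lemma integral_derivative:
  fixes f f' :: "real \<Rightarrow> real"
  assumes f: "\<And>t. t \<in> {0..1} \<Longrightarrow> (f has_real_derivative f' t) (at t within {0..1})"
    and t: "t \<in> {0..1}"
  shows "(f' has_integral f t - f 0) {0..t}"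
proof (rule fundamental_theorem_of_calculus)
  fix x assume "x \<in> {0..t}"
  then show "(f has_vector_derivative f' x) (at x within {0..t})"
    using f[of x] t unfolding has_real_derivative_iff_has_vector_derivative
    by (auto elim: has_vector_derivative_within_subset)
qed (use t in auto)

lemma abs_integral_le:
  fixes f :: "real \<Rightarrow> real"
  assumes "continuous_on {0..1} f" "t \<in> {0..1}" "\<And>s. s \<in> {0..1} \<Longrightarrow> \<bar>f s\<bar> \<le> c"
  shows "\<bar>integral {0..t} f\<bar> \<le> c"
proof -
  have "norm (integral {0..t} f) \<le> c * (t - 0)"
    using assms by (intro integral_bound) (auto intro: continuous_on_subset)
  also have "\<dots> \<le> c"
    using assms(2) assms(3)[of 0] by (intro mult_left_le) auto
  finally show ?thesis by simp
qed

text \<open>The form is the quotient (a^3 - b^3)/(a - b), so this controls the Lipschitz constant of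
  the cubic term.\<close>

lemma abs_square_form_le:
  fixes a b r :: real
  assumes "\<bar>a\<bar> \<le> r" "\<bar>b\<bar> \<le> r"
  shows "\<bar>a^2 + a * b + b^2\<bar> \<le> 3 * r^2"
proof -
  have "\<bar>a * b\<bar> \<le> r * r" unfolding abs_mult using assms by (intro mult_mono) auto
  moreover have "a^2 \<le> r^2" "b^2 \<le> r^2"
    using power_mono[OF assms(1), of 2] power_mono[OF assms(2), of 2] by simp_all
  moreover have "0 \<le> a^2" "0 \<le> b^2" by simp_all
  ultimately show ?thesis unfolding power2_eq_square by linarith
qed

text \<open>Multiplication by the integrating factor \<open>exp (- integral {0..t} K)\<close> turns
  \<open>e\<close> into a function of zero derivative.\<close>

lemma linear_ode_solution:
  fixes e K :: "real \<Rightarrow> real"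
  assumes K: "continuous_on {0..1} K"
    and e: "\<And>t. t \<in> {0..1} \<Longrightarrow> (e has_real_derivative e t * K t) (at t within {0..1})"
    and t: "t \<in> {0..1}"
  shows "e t = e 0 * exp (integral {0..t} K)"
proof -
  let ?f = "\<lambda>t. e t * exp (- integral {0..t} K)"
  have "(?f has_real_derivative 0) (at t within {0..1})" if "t \<in> {0..1}" for t
    by (rule derivative_eq_intros e integral_has_real_derivative[OF K] that refl)+ simp
  then obtain c where c: "\<And>t. t \<in> {0..1} \<Longrightarrow> ?f t = c"
    using has_field_derivative_zero_constant[of "{0..1}" ?f] by auto
  have "e 0 = c" using c[of 0] by simp
  then show ?thesis using c[OF t] by (simp add: exp_minus field_simps)
qed

section \<open>Comparison of two solutions, uniqueness, dependence on the initial value\<close>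

locale abel =
  fixes A B :: "real \<Rightarrow> real"
  assumes contA: "continuous_on {0..1} A" and contB: "continuous_on {0..1} B"
begin

lemma sol_deriv:
  assumes "abel_sol A B x0 u" "t \<in> {0..1}"
  shows "(u has_real_derivative (A t * (u t)^3 + B t * (u t)^2)) (at t within {0..1})"
  using assms by (simp add: abel_sol_def)

lemma sol_init: "abel_sol A B x0 u \<Longrightarrow> u 0 = x0"
  by (simp add: abel_sol_def)

lemma sol_cont:
  assumes "abel_sol A B x0 u"
  shows "continuous_on {0..1} u"
  using sol_deriv[OF assms] by (rule DERIV_continuous_on)

lemma sol_zero: "abel_sol A B 0 (\<lambda>_. 0)"
  by (simp add: abel_sol_def)

text \<open>The divided difference in x of the right-hand side between two solutions. For
  \<open>u = v\<close> it is the coefficient of the variational equation.\<close>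

definition slope :: "(real \<Rightarrow> real) \<Rightarrow> (real \<Rightarrow> real) \<Rightarrow> real \<Rightarrow> real" where
  "slope u v t = A t * ((u t)^2 + u t * v t + (v t)^2) + B t * (u t + v t)"

lemma slope_cont:
  assumes "abel_sol A B x0 u" "abel_sol A B y0 v"
  shows "continuous_on {0..1} (slope u v)"
  unfolding slope_def
  by (intro continuous_intros contA contB sol_cont[OF assms(1)] sol_cont[OF assms(2)])

text \<open>The difference of two solutions solves a linear equation with coefficient
  \<open>slope u v\<close>. Uniqueness, non-crossing and the derivative of the Poincare map are all
  read off from this exact formula.\<close>

lemma sol_diff:
  assumes u: "abel_sol A B x0 u" and v: "abel_sol A B y0 v" and t: "t \<in> {0..1}"
  shows "v t - u t = (y0 - x0) * exp (integral {0..t} (slope u v))"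
proof -
  have "((\<lambda>t. v t - u t) has_real_derivative (v t - u t) * slope u v t) (at t within {0..1})"
    if "t \<in> {0..1}" for t
    by (rule derivative_eq_intros sol_deriv[OF u] sol_deriv[OF v] that refl)+
      (simp add: slope_def algebra_simps power2_eq_square power3_eq_cube)
  from linear_ode_solution[OF slope_cont[OF u v] this t] show ?thesis
    using sol_init[OF u] sol_init[OF v] by simp
qed

lemma sol_unique:
  assumes "abel_sol A B x0 u" "abel_sol A B x0 v" "t \<in> {0..1}"
  shows "u t = v t"
  using sol_diff[OF assms] by simp

lemma sol_distinct:
  assumes "abel_sol A B x0 u" "abel_sol A B y0 v" "x0 \<noteq> y0" "t \<in> {0..1}"
  shows "u t \<noteq> v t"
  using sol_diff[OF assms(1,2,4)] assms(3) by auto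

lemma sol_nonzero:
  assumes "abel_sol A B x0 u" "x0 \<noteq> 0" "t \<in> {0..1}"
  shows "u t \<noteq> 0"
  using sol_distinct[OF assms(1) sol_zero assms(2,3)] .

lemma poincare_eq:
  assumes "abel_sol A B x0 u"
  shows "poincare A B x0 = u 1"
  unfolding poincare_def
  using assms sol_unique[OF _ assms] by (intro the_equality) (metis atLeastAtMost_iff order_refl zero_le_one)+

text \<open>The normalisation \<open>M \<ge> 1\<close> allows lower powers of \<open>M\<close> to be
  absorbed into higher ones.\<close>

lemma bounded_coeffs:
  obtains M where "M \<ge> 1" "\<And>t. t \<in> {0..1} \<Longrightarrow> \<bar>A t\<bar> \<le> M" "\<And>t. t \<in> {0..1} \<Longrightarrow> \<bar>B t\<bar> \<le> M"
proof -
  have "bounded (A ` {0..1})" "bounded (B ` {0..1})"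
    by (intro compact_imp_bounded compact_continuous_image contA contB compact_Icc)+
  then obtain a b where "\<forall>t\<in>{0..1}. \<bar>A t\<bar> \<le> a" "\<forall>t\<in>{0..1}. \<bar>B t\<bar> \<le> b"
    by (auto simp: bounded_iff)
  then show ?thesis
    by (intro that[of "max 1 (max a b)"]) (auto simp: le_max_iff_disj)
qed

text \<open>Boundedness of \<open>v\<close> is not known in advance: \<open>s\<close> below is the first time at which the two
  solutions are \<open>\<eta>\<close> apart, and up to then the slope is bounded.\<close>

lemma continuous_dependence:
  assumes u: "abel_sol A B x0 u" and eta: "0 < \<eta>"
  obtains \<delta> where "0 < \<delta>"
    "\<And>y0 v t. abel_sol A B y0 v \<Longrightarrow> \<bar>y0 - x0\<bar> < \<delta> \<Longrightarrow> t \<in> {0..1} \<Longrightarrow> \<bar>v t - u t\<bar> < \<eta>"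
proof -
  obtain M where M: "M \<ge> 1" "\<And>t. t \<in> {0..1} \<Longrightarrow> \<bar>A t\<bar> \<le> M" "\<And>t. t \<in> {0..1} \<Longrightarrow> \<bar>B t\<bar> \<le> M"
    using bounded_coeffs by blast
  have "bounded (u ` {0..1})"
    by (intro compact_imp_bounded compact_continuous_image sol_cont[OF u] compact_Icc)
  then obtain r0 where r0: "\<forall>t\<in>{0..1}. \<bar>u t\<bar> \<le> r0"
    by (auto simp: bounded_iff)
  \<comment> \<open>As long as the solutions are less than \<eta> apart, \<open>r\<close> bounds
    both of them and \<open>L\<close> bounds the slope.\<close>
  define r where "r = \<bar>r0\<bar> + \<eta>"
  have r: "0 < r" "\<And>t. t \<in> {0..1} \<Longrightarrow> \<bar>u t\<bar> + \<eta> \<le> r"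
    using r0 eta by (force simp: r_def)+
  define L where "L = M * (3 * r^2) + M * (2 * r)"
  show ?thesis
  \<comment> \<open>Up to the first exit time the initial distance grows at most by the factor
    \<open>exp L\<close>, so this radius keeps it below \<eta>.\<close>
  proof (rule that[of "\<eta> * exp (- L)"])
    show "0 < \<eta> * exp (- L)" using eta by simp
    fix y0 v t1
    assume v: "abel_sol A B y0 v" and y0: "\<bar>y0 - x0\<bar> < \<eta> * exp (- L)" and t1: "t1 \<in> {0..1::real}"
    show "\<bar>v t1 - u t1\<bar> < \<eta>"
    proof (rule ccontr)
      assume neg: "\<not> \<bar>v t1 - u t1\<bar> < \<eta>"
      define e where "e t = \<bar>v t - u t\<bar>" for t
      have ce: "continuous_on {0..1} e"
        unfolding e_def by (intro continuous_intros sol_cont[OF u] sol_cont[OF v])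
      define S where "S = {t \<in> {0..1}. \<eta> \<le> e t}"
      have "closed S"
        unfolding S_def using continuous_closed_preimage[OF ce closed_atLeastAtMost, of "{\<eta>..}"]
        by (simp add: vimage_def Int_def conj_commute)
      then have "compact S"
        by (metis (no_types, lifting) S_def compact_Icc compact_Int_closed inf.absorb_iff2 mem_Collect_eq subsetI)
      moreover have "S \<noteq> {}" using neg t1 by (auto simp: S_def e_def)
      ultimately obtain s where s: "s \<in> S" "\<And>t. t \<in> S \<Longrightarrow> s \<le> t"
        using compact_attains_inf[of S] by auto
      have s01: "s \<in> {0..1}" and es: "\<eta> \<le> e s" using s by (auto simp: S_def)
      have below: "e t < \<eta>" if "t \<in> {0..<s}" for t
        using s(2)[of t] that s01 by (force simp: S_def)
      have "\<bar>slope u v t\<bar> \<le> L" if t: "t \<in> {0..<s}" for t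
      proof -
        have t': "t \<in> {0..1}" using t s01 by auto
        have uv: "\<bar>u t\<bar> \<le> r" "\<bar>v t\<bar> \<le> r"
          using below[OF t] r(2)[OF t'] eta by (auto simp: e_def)
        have "\<bar>(u t)^2 + u t * v t + (v t)^2\<bar> \<le> 3 * r^2"
          using uv by (rule abs_square_form_le)
        moreover have "\<bar>u t + v t\<bar> \<le> 2 * r" using uv by linarith
        ultimately have "\<bar>A t * ((u t)^2 + u t * v t + (v t)^2)\<bar> \<le> M * (3 * r^2)"
          "\<bar>B t * (u t + v t)\<bar> \<le> M * (2 * r)"
          using M(1) M(2,3)[OF t'] unfolding abs_mult by (auto intro!: mult_mono)
        then show ?thesis unfolding slope_def L_def by linarith
      qed
      then have bd: "\<bar>slope u v t\<bar> \<le> L" if "t \<in> {0<..<s}" for t using that by auto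
      have cs: "continuous_on {0..s} (slope u v)"
        by (rule continuous_on_subset[OF slope_cont[OF u v]]) (use s01 in auto)
      have L0: "0 \<le> L" using r(1) M(1) by (simp add: L_def)
      have "integral {0..s} (slope u v) \<le> L"
      proof -
        \<comment> \<open>The bound on the slope is at hand only inside the interval, so the
          integrand is set to 0 at the two endpoints.\<close>
        have "((\<lambda>t. if t \<in> {0<..<s} then slope u v t else 0) has_integral integral {0..s} (slope u v)) {0..s}"
          by (rule has_integral_spike_finite[of "{0, s}" _ _ "slope u v"])
            (auto intro!: integrable_integral integrable_continuous_real cs)
        moreover have "((\<lambda>_. L) has_integral (s - 0) *\<^sub>R L) {0..s}"
          using has_integral_const_real[of L 0 s] s01 by auto
        ultimately have "integral {0..s} (slope u v) \<le> (s - 0) *\<^sub>R L"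
        proof (rule has_integral_le)
          show "(if t \<in> {0<..<s} then slope u v t else 0) \<le> L" if "t \<in> {0..s}" for t
            using bd[of t] L0 by auto
        qed
        also have "\<dots> \<le> L" using s01 L0 by (simp add: mult_left_le_one_le)
        finally show ?thesis .
      qed
      then have "e s \<le> \<bar>y0 - x0\<bar> * exp L"
        unfolding e_def sol_diff[OF u v s01] abs_mult by (simp add: mult_left_mono)
      also have "\<dots> < \<eta>"
        using y0 by (simp add: exp_minus field_simps)
      finally show False using es by simp
    qed
  qed
qed

text \<open>Since the derivative is taken within the domain of the Poincare map, no existence result for
  nearby solutions is needed.\<close>

lemma poincare_deriv:
  assumes u: "abel_sol A B x0 u"
  shows "(poincare A B has_real_derivative exp (integral {0..1} (\<lambda>t. 3 * A t * (u t)^2 + 2 * B t * u t)))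
    (at x0 within abel_dom A B)"
proof -
  define v where "v y = (SOME v. abel_sol A B y v)" for y
  have v: "abel_sol A B y (v y)" if "y \<in> abel_dom A B" for y
    using that someI_ex[of "abel_sol A B y"] by (auto simp: v_def abel_dom_def)
  obtain M where M: "M \<ge> 1" "\<And>t. t \<in> {0..1} \<Longrightarrow> \<bar>A t\<bar> \<le> M" "\<And>t. t \<in> {0..1} \<Longrightarrow> \<bar>B t\<bar> \<le> M"
    using bounded_coeffs by blast
  have "bounded (u ` {0..1})"
    by (intro compact_imp_bounded compact_continuous_image sol_cont[OF u] compact_Icc)
  then obtain r where r: "\<forall>t\<in>{0..1}. \<bar>u t\<bar> \<le> r"
    by (auto simp: bounded_iff)
  then have r0: "0 \<le> r" by force
  define L where "L = M * (3 * r + 2)"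
  have L: "0 < L" using M(1) r0 by (simp add: L_def)
  have slope_uu: "slope u u = (\<lambda>t. 3 * A t * (u t)^2 + 2 * B t * u t)"
    by (rule ext) (simp add: slope_def power2_eq_square algebra_simps)
  \<comment> \<open>By \<open>sol_diff\<close> the difference quotient of the Poincare map is
    exactly the exponential of this integral, so only the convergence of the slopes remains to be
    shown.\<close>
  have "((\<lambda>y. integral {0..1} (slope u (v y))) \<longlongrightarrow> integral {0..1} (slope u u)) (at x0 within abel_dom A B)"
  proof (rule tendstoI)
    fix \<epsilon> :: real assume eps: "0 < \<epsilon>"
    define \<eta> where "\<eta> = min 1 (\<epsilon> / (2 * L))"
    have eta: "0 < \<eta>" "\<eta> \<le> 1" "\<eta> * L < \<epsilon>"
      using eps L by (auto simp: \<eta>_def min_def field_simps)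
    obtain \<delta> where \<delta>: "0 < \<delta>"
      "\<And>y0 v t. abel_sol A B y0 v \<Longrightarrow> \<bar>y0 - x0\<bar> < \<delta> \<Longrightarrow> t \<in> {0..1} \<Longrightarrow> \<bar>v t - u t\<bar> < \<eta>"
      using continuous_dependence[OF u eta(1)] by blast
    have "dist (integral {0..1} (slope u (v y))) (integral {0..1} (slope u u)) < \<epsilon>"
      if y: "y \<in> abel_dom A B" "\<bar>y - x0\<bar> < \<delta>" for y
    proof -
      note vy = v[OF y(1)]
      have "\<bar>slope u (v y) t - slope u u t\<bar> \<le> \<eta> * L" if t: "t \<in> {0..1}" for t
      proof -
        define e where "e = v y t - u t"
        have e: "\<bar>e\<bar> \<le> \<eta>" "\<bar>e\<bar> \<le> 1" using \<delta>(2)[OF vy y(2) t] eta by (auto simp: e_def)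
        have "v y t = u t + e" by (simp add: e_def)
        then have "slope u (v y) t - slope u u t = e * (A t * (3 * u t + e) + B t)"
          by (simp add: slope_def power2_eq_square algebra_simps)
        moreover have "\<bar>A t * (3 * u t + e)\<bar> \<le> M * (3 * r + 1)"
          unfolding abs_mult using M(1,2) t r[rule_format, OF t] e(2)
          by (intro mult_mono) auto
        then have "\<bar>A t * (3 * u t + e) + B t\<bar> \<le> L"
          using M(3)[OF t] by (simp add: L_def algebra_simps)
        ultimately show ?thesis
          using e(1) by (auto simp: abs_mult intro!: mult_mono)
      qed
      then have "\<bar>integral {0..1} (\<lambda>t. slope u (v y) t - slope u u t)\<bar> \<le> \<eta> * L"
        by (intro abs_integral_le continuous_intros slope_cont[OF u vy] slope_cont[OF u u]) auto
      also have "integral {0..1} (\<lambda>t. slope u (v y) t - slope u u t)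
          = integral {0..1} (slope u (v y)) - integral {0..1} (slope u u)"
        by (intro integral_diff integrable_continuous_real slope_cont[OF u vy] slope_cont[OF u u])
      finally show ?thesis using eta(3) by (simp add: dist_real_def)
    qed
    then show "\<forall>\<^sub>F y in at x0 within abel_dom A B.
        dist (integral {0..1} (slope u (v y))) (integral {0..1} (slope u u)) < \<epsilon>"
      using \<delta>(1) unfolding eventually_at by (auto simp: dist_real_def)
  qed
  from tendsto_exp[OF this]
  have lim: "((\<lambda>y. exp (integral {0..1} (slope u (v y)))) \<longlongrightarrow> exp (integral {0..1} (slope u u)))
    (at x0 within abel_dom A B)" .
  have "exp (integral {0..1} (slope u (v y))) = (poincare A B y - poincare A B x0) / (y - x0)"
    if "y \<in> abel_dom A B" "y \<noteq> x0" for y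
    using sol_diff[OF u v[OF that(1)], of 1] that
    by (simp add: poincare_eq[OF u] poincare_eq[OF v[OF that(1)]])
  then have "((\<lambda>y. (poincare A B y - poincare A B x0) / (y - x0)) \<longlongrightarrow> exp (integral {0..1} (slope u u)))
    (at x0 within abel_dom A B)"
    by (intro Lim_transform_eventually[OF lim]) (auto simp: eventually_at intro!: exI[of _ 1])
  then show ?thesis
    unfolding has_field_derivative_iff slope_uu .
qed

lemma poincare_cont: "continuous_on (abel_dom A B) (poincare A B)"
proof (rule DERIV_continuous_on)
  fix x assume "x \<in> abel_dom A B"
  then have "\<exists>u. abel_sol A B x u" by (simp add: abel_dom_def)
  then have "abel_sol A B x (SOME u. abel_sol A B x u)" by (rule someI_ex)
  then show "(poincare A B has_real_derivative exp (integral {0..1} (\<lambda>t. 3 * A t * ((SOME u. abel_sol A B x u) t)^2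
    + 2 * B t * (SOME u. abel_sol A B x u) t))) (at x within abel_dom A B)"
    by (rule poincare_deriv)
qed

lemma hyperbolicI:
  assumes u: "abel_sol A B x0 u" "u 1 = x0"
    and "integral {0..1} (\<lambda>t. 3 * A t * (u t)^2 + 2 * B t * u t) \<noteq> 0"
  shows "hyperbolic_orbit A B x0"
  unfolding hyperbolic_orbit_def periodic_orbit_def
proof
  show "\<exists>u. abel_sol A B x0 u \<and> u 1 = x0" using u by blast
  show "\<exists>d. (poincare A B has_real_derivative d) (at x0 within abel_dom A B) \<and> d \<noteq> 1"
    by (rule exI, rule conjI, rule poincare_deriv[OF u(1)]) (use assms(3) in simp)
qed

text \<open>Picard iteration: since M |x0| and |x0| are at most 1/16, the integral operator maps the
  functions bounded by 2 |x0| into themselves and contracts distances by 1/2.\<close>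

lemma small_solution_exists:
  assumes M: "M \<ge> 1" "\<And>t. t \<in> {0..1} \<Longrightarrow> \<bar>A t\<bar> \<le> M" "\<And>t. t \<in> {0..1} \<Longrightarrow> \<bar>B t\<bar> \<le> M"
    and x0: "\<bar>x0\<bar> \<le> 1 / (16 * M)"
  obtains u where "abel_sol A B x0 u" "\<And>t. t \<in> {0..1} \<Longrightarrow> \<bar>u t\<bar> \<le> 2 * \<bar>x0\<bar>"
proof -
  \<comment> \<open>Clamping the time to the unit interval lets the operator act on bounded
    continuous functions on the whole line, a complete space.\<close>
  define k :: "real \<Rightarrow> real" where "k t = max 0 (min 1 t)" for t
  have k: "k t \<in> {0..1}" for t by (auto simp: k_def)
  have k_id: "k t = t" if "t \<in> {0..1}" for t using that by (auto simp: k_def)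
  have ck: "continuous_on UNIV k" unfolding k_def by (intro continuous_intros)
  define g where "g w t = A t * (w t)^3 + B t * (w t)^2" for w :: "real \<Rightarrow> real" and t
  define S where "S = PiC (UNIV :: real set) (\<lambda>_. {- (2 * \<bar>x0\<bar>) .. 2 * \<bar>x0\<bar>})"
  define F where "F w t = x0 + integral {0..k t} (g w)" for w t
  \<comment> \<open>\<open>Bcontfun\<close> is only meaningful for bounded continuous arguments; for
    \<open>w\<close> in \<open>S\<close> this is ensured by \<open>Fbd\<close> and
    \<open>cF\<close>.\<close>
  define T where "T w = Bcontfun (F (apply_bcontfun w))" for w
  have Mx: "M * \<bar>x0\<bar> \<le> 1 / 16" using x0 M(1) by (simp add: field_simps)
  have xsmall: "\<bar>x0\<bar> \<le> 1 / 16"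
    using x0 M(1) by (smt (verit, best) Mx abs_ge_zero mult_le_cancel_right1)
  have bd: "\<bar>apply_bcontfun w t\<bar> \<le> 2 * \<bar>x0\<bar>" if "w \<in> S" for w t
    using that by (auto simp: S_def mem_PiC_iff Pi_iff abs_le_iff) (smt (verit))
  have cg: "continuous_on {0..1} (g (apply_bcontfun w))" for w
    unfolding g_def by (intro continuous_intros contA contB continuous_on_apply_bcontfun)
  have Fbd: "\<bar>F (apply_bcontfun w) t\<bar> \<le> 2 * \<bar>x0\<bar>" if w: "w \<in> S" for w t
  proof -
    have "\<bar>integral {0..k t} (g (apply_bcontfun w))\<bar> \<le> \<bar>x0\<bar>"
    proof (rule abs_integral_le[OF cg k])
      fix s :: real assume s: "s \<in> {0..1}"
      have w2: "\<bar>apply_bcontfun w s\<bar>^2 \<le> (2 * \<bar>x0\<bar>)^2" and w3: "\<bar>apply_bcontfun w s\<bar>^3 \<le> (2 * \<bar>x0\<bar>)^3"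
        by (rule power_mono[OF bd[OF w] abs_ge_zero])+
      have "\<bar>g (apply_bcontfun w) s\<bar> \<le> \<bar>A s\<bar> * \<bar>apply_bcontfun w s\<bar>^3 + \<bar>B s\<bar> * \<bar>apply_bcontfun w s\<bar>^2"
        unfolding g_def by (metis abs_mult abs_triangle_ineq power_abs)
      also have "\<dots> \<le> M * (2 * \<bar>x0\<bar>)^3 + M * (2 * \<bar>x0\<bar>)^2"
        using M s w2 w3 by (intro add_mono mult_mono) auto
      also have "\<dots> = (M * \<bar>x0\<bar>) * (8 * \<bar>x0\<bar> + 4) * \<bar>x0\<bar>"
        by (simp add: power2_eq_square power3_eq_cube algebra_simps)
      also have "\<dots> \<le> (1 / 16) * (8 * (1 / 16) + 4) * \<bar>x0\<bar>"
        using Mx xsmall M(1) by (intro mult_mono mult_right_mono add_mono) auto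
      also have "\<dots> \<le> \<bar>x0\<bar>" by simp
      finally show "\<bar>g (apply_bcontfun w) s\<bar> \<le> \<bar>x0\<bar>" .
    qed
    then show ?thesis unfolding F_def by linarith
  qed
  have cF: "continuous_on UNIV (F (apply_bcontfun w))" for w
  proof -
    have "continuous_on {0..1} (\<lambda>t. integral {0..t} (g (apply_bcontfun w)))"
      by (intro indefinite_integral_continuous_1 integrable_continuous_real cg)
    then have "continuous_on UNIV (\<lambda>t. integral {0..k t} (g (apply_bcontfun w)))"
      by (rule continuous_on_compose2[OF _ ck]) (use k in auto)
    then show ?thesis unfolding F_def by (intro continuous_intros)
  qed
  have T: "apply_bcontfun (T w) = F (apply_bcontfun w)" if "w \<in> S" for w
    unfolding T_def by (intro Bcontfun_inverse bcontfun_normI[OF cF]) (use Fbd[OF that] in auto)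
  have "\<exists>!w\<in>S. T w = w"
  proof (rule Banach_fix[where c = "1/2"])
    show "complete S"
      unfolding S_def by (intro closed_PiC[THEN complete_eq_closed[THEN iffD2]]) auto
    have "const_bcontfun 0 \<in> S" by (auto simp: S_def mem_PiC_iff)
    then show "S \<noteq> {}" by blast
    show "T ` S \<subseteq> S"
    proof
      fix w' assume "w' \<in> T ` S"
      then obtain w where w: "w \<in> S" "w' = T w" by blast
      have "\<And>t. - (2 * \<bar>x0\<bar>) \<le> F (apply_bcontfun w) t \<and> F (apply_bcontfun w) t \<le> 2 * \<bar>x0\<bar>"
        using Fbd[OF w(1)] by (simp add: abs_le_iff) (smt (verit))
      then show "w' \<in> S" by (simp add: w(2) S_def mem_PiC_iff T[OF w(1)])
    qed
    fix p q assume pq: "p \<in> S" "q \<in> S"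
    show "dist (T p) (T q) \<le> 1 / 2 * dist p q"
    proof (rule dist_bound)
      fix t
      have "\<bar>integral {0..k t} (\<lambda>s. g p s - g q s)\<bar> \<le> 1 / 2 * dist p q"
      proof (rule abs_integral_le[OF _ k])
        show "continuous_on {0..1} (\<lambda>s. g p s - g q s)" by (intro continuous_intros cg)
        fix s :: real assume s: "s \<in> {0..1}"
        let ?p = "apply_bcontfun p s" and ?q = "apply_bcontfun q s"
        have b: "\<bar>?p\<bar> \<le> 2 * \<bar>x0\<bar>" "\<bar>?q\<bar> \<le> 2 * \<bar>x0\<bar>" using bd pq by auto
        have "\<bar>?p^2 + ?p * ?q + ?q^2\<bar> \<le> 3 * (2 * \<bar>x0\<bar>)^2"
          using b by (rule abs_square_form_le)
        also have "\<dots> = 12 * \<bar>x0\<bar> * \<bar>x0\<bar>" by (simp add: power2_eq_square)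
        finally have 1: "\<bar>A s * (?p^2 + ?p * ?q + ?q^2)\<bar> \<le> M * (12 * \<bar>x0\<bar> * \<bar>x0\<bar>)"
          unfolding abs_mult using M s by (intro mult_mono) auto
        have 2: "\<bar>B s * (?p + ?q)\<bar> \<le> M * (4 * \<bar>x0\<bar>)"
          unfolding abs_mult using M s b by (intro mult_mono) auto
        have "M * (12 * \<bar>x0\<bar> * \<bar>x0\<bar>) + M * (4 * \<bar>x0\<bar>) = (M * \<bar>x0\<bar>) * (12 * \<bar>x0\<bar> + 4)"
          by (simp add: algebra_simps)
        also have "\<dots> \<le> (1 / 16) * (12 * (1 / 16) + 4)"
          using Mx xsmall M(1) by (intro mult_mono) auto
        finally have "M * (12 * \<bar>x0\<bar> * \<bar>x0\<bar>) + M * (4 * \<bar>x0\<bar>) \<le> 1 / 2" by simp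
        with 1 2 have 3: "\<bar>A s * (?p^2 + ?p * ?q + ?q^2) + B s * (?p + ?q)\<bar> \<le> 1 / 2"
          by linarith
        have "g p s - g q s = (A s * (?p^2 + ?p * ?q + ?q^2) + B s * (?p + ?q)) * (?p - ?q)"
          by (simp add: g_def power2_eq_square power3_eq_cube algebra_simps)
        then have "\<bar>g p s - g q s\<bar> \<le> 1 / 2 * \<bar>?p - ?q\<bar>"
          using mult_right_mono[OF 3, of "\<bar>?p - ?q\<bar>"] by (simp add: abs_mult)
        also have "\<dots> \<le> 1 / 2 * dist p q"
          using dist_bounded[of p s q] by (simp add: dist_real_def)
        finally show "\<bar>g p s - g q s\<bar> \<le> 1 / 2 * dist p q" .
      qed
      moreover have "integral {0..k t} (\<lambda>s. g p s - g q s) = integral {0..k t} (g p) - integral {0..k t} (g q)"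
        by (intro integral_diff integrable_continuous_real continuous_on_subset[OF cg]) (use k[of t] in auto)
      ultimately show "dist (T p t) (T q t) \<le> 1 / 2 * dist p q"
        by (simp add: T[OF pq(1)] T[OF pq(2)] F_def dist_real_def)
    qed
  qed auto
  then obtain w where w: "w \<in> S" "T w = w" by blast
  have fix_eq: "apply_bcontfun w t = x0 + integral {0..t} (g w)" if "t \<in> {0..1}" for t
    using T[OF w(1)] w(2) k_id[OF that] by (metis F_def)
  have "(apply_bcontfun w has_real_derivative g w t) (at t within {0..1})" if t: "t \<in> {0..1}" for t
  proof (rule has_field_derivative_transform_within[OF _ zero_less_one t])
    show "((\<lambda>t. x0 + integral {0..t} (g w)) has_real_derivative g w t) (at t within {0..1})"
      by (rule derivative_eq_intros integral_has_real_derivative[OF cg t] refl)+ simp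
  qed (simp add: fix_eq)
  moreover have "apply_bcontfun w 0 = x0" using fix_eq[of 0] by simp
  ultimately have "abel_sol A B x0 w" by (simp add: abel_sol_def g_def)
  then show ?thesis using that bd[OF w(1)] by blast
qed

end

subsection \<open>Expansion at the origin\<close>

lemma integral_diff2:
  fixes f g h :: "real \<Rightarrow> real"
  assumes "continuous_on {0..1} f" "continuous_on {0..1} g" "continuous_on {0..1} h"
  shows "integral {0..1} (\<lambda>t. f t - p * g t - q * h t)
    = integral {0..1} f - p * integral {0..1} g - q * integral {0..1} h"
proof -
  have "f integrable_on {0..1}" "g integrable_on {0..1}" "h integrable_on {0..1}"
    using assms by (auto intro: integrable_continuous_real)
  then have "((\<lambda>t. f t - p * g t - q * h t) has_integral
      integral {0..1} f - p * integral {0..1} g - q * integral {0..1} h) {0..1}"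
    by (intro has_integral_diff has_integral_mult_right integrable_integral)
  then show ?thesis by (rule integral_unique)
qed

text \<open>\<open>ln ((f t)^2) / 2\<close> stands for ln |f|, so that no case distinction on the
  sign of f arises.\<close>

lemma log_square_deriv:
  fixes f :: "real \<Rightarrow> real"
  assumes "(f has_real_derivative D) (at t within S)" "f t \<noteq> 0"
  shows "((\<lambda>t. ln ((f t)^2) / 2) has_real_derivative D / f t) (at t within S)"
  using assms zero_less_power2[of "f t"]
  by (auto intro!: derivative_eq_intros simp: divide_simps) (simp add: power2_eq_square)

lemma (in abel) reciprocal_deriv:
  assumes u: "abel_sol A B x0 u" "x0 \<noteq> 0" and t: "t \<in> {0..1}"
  shows "((\<lambda>t. 1 / u t) has_real_derivative - (A t * u t + B t)) (at t within {0..1})"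
  using sol_nonzero[OF u t]
  by (auto intro!: derivative_eq_intros sol_deriv[OF u(1) t] simp: field_simps power2_eq_square power3_eq_cube)

text \<open>On a periodic orbit ln |u| returns to its initial value, so A u^2 + B u has integral
  zero and multiples of it may be removed from the exponent of the derivative of the Poincare
  map.\<close>

lemma (in abel) log_deriv:
  assumes u: "abel_sol A B x0 u" "x0 \<noteq> 0" and t: "t \<in> {0..1}"
  shows "((\<lambda>t. ln ((u t)^2) / 2) has_real_derivative A t * (u t)^2 + B t * u t) (at t within {0..1})"
  by (rule DERIV_cong[OF log_square_deriv[OF sol_deriv[OF u(1) t] sol_nonzero[OF u t]]])
    (use sol_nonzero[OF u t] in \<open>simp add: field_simps power2_eq_square power3_eq_cube\<close>)

text \<open>The bound on \<open>x0\<close> is that of \<open>small_solution_exists\<close>; with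
  uniqueness it gives |u| <= 2 |x0|, where all the estimates start.\<close>

locale abel_small = abel +
  fixes M x0 u Bt
  assumes M: "M \<ge> 1" "\<And>t. t \<in> {0..1} \<Longrightarrow> \<bar>A t\<bar> \<le> M" "\<And>t. t \<in> {0..1} \<Longrightarrow> \<bar>B t\<bar> \<le> M"
    and x0: "x0 \<noteq> 0" "\<bar>x0\<bar> \<le> 1 / (16 * M)"
    and sol: "abel_sol A B x0 u"
    and Bt: "\<And>t. t \<in> {0..1} \<Longrightarrow> (Bt has_real_derivative B t) (at t within {0..1})" "Bt 0 = 0"
begin

lemma x0_small: "M * \<bar>x0\<bar> \<le> 1 / 16"
  using x0 M(1) by (simp add: field_simps)

lemma abs_powers: "\<bar>x0\<bar>^3 = \<bar>x0\<bar> * x0^2" "x0^4 = \<bar>x0\<bar> * (\<bar>x0\<bar> * x0^2)"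
  by (simp_all add: power3_eq_cube power4_eq_xxxx power2_eq_square flip: mult.assoc)

lemma u_small: "t \<in> {0..1} \<Longrightarrow> \<bar>u t\<bar> \<le> 2 * \<bar>x0\<bar>"
  using small_solution_exists[OF M x0(2)] sol_unique[OF sol] by metis

lemma Bt_cont: "continuous_on {0..1} Bt"
  using Bt(1) by (rule DERIV_continuous_on)

lemma Bt_bound:
  assumes "t \<in> {0..1}"
  shows "\<bar>Bt t\<bar> \<le> M"
  using abs_integral_le[OF contB assms M(3)] integral_derivative[OF Bt(1) assms] Bt(2)
  by (simp add: integral_unique)

text \<open>The integrated reciprocal equation is exact; inserting a better approximation of
  \<open>u\<close> on the right improves the expansion of 1/u.\<close>

lemma reciprocal_diff:
  assumes t: "t \<in> {0..1}"
  shows "1 / x0 - 1 / u t - Bt t = integral {0..t} (\<lambda>t. A t * u t)"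
proof -
  have "((\<lambda>t. - (1 / u t) - Bt t) has_real_derivative A t * u t) (at t within {0..1})" if "t \<in> {0..1}" for t
    by (rule derivative_eq_intros reciprocal_deriv[OF sol x0(1) that] Bt(1) that refl)+ simp
  from integral_unique[OF integral_derivative[OF this t]] show ?thesis
    using sol_init[OF sol] Bt(2) by simp
qed

lemma reciprocal_diff_bound:
  assumes t: "t \<in> {0..1}"
  shows "\<bar>1 / x0 - 1 / u t - Bt t\<bar> \<le> 2 * M * \<bar>x0\<bar>" "\<bar>1 / x0 - 1 / u t\<bar> \<le> 2 * M"
proof -
  have "\<bar>A t * u t\<bar> \<le> 2 * M * \<bar>x0\<bar>" if "t \<in> {0..1}" for t
    using mult_mono[OF M(2)[OF that] u_small[OF that]] M(1) by (simp add: abs_mult)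
  then show *: "\<bar>1 / x0 - 1 / u t - Bt t\<bar> \<le> 2 * M * \<bar>x0\<bar>"
    unfolding reciprocal_diff[OF t]
    by (intro abs_integral_le continuous_intros contA sol_cont[OF sol] t)
  show "\<bar>1 / x0 - 1 / u t\<bar> \<le> 2 * M"
    using * Bt_bound[OF t] x0_small M(1) by linarith
qed

text \<open>Converts estimates for reciprocals into estimates for \<open>u\<close>, with a gain of
  the factor \<open>x0 * u t\<close>, which is of order x0^2.\<close>

lemma u_diff:
  assumes t: "t \<in> {0..1}"
  shows "u t - x0 = x0 * u t * (1 / x0 - 1 / u t)"
  using x0 sol_nonzero[OF sol x0(1) t] by (simp add: field_simps)

lemma expansion_first: 
  assumes t: "t \<in> {0..1}"
  shows "\<bar>u t - x0\<bar> \<le> 4 * M * x0^2"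
proof -
  have "\<bar>u t - x0\<bar> \<le> \<bar>x0\<bar> * (2 * \<bar>x0\<bar>) * (2 * M)"
    unfolding u_diff[OF t] abs_mult using u_small[OF t] reciprocal_diff_bound(2)[OF t] M(1)
    by (intro mult_mono) auto
  also have "\<dots> = 4 * M * \<bar>x0\<bar>^2" by algebra
  finally show ?thesis by simp
qed

lemma expansion_second:
  assumes t: "t \<in> {0..1}"
  shows "\<bar>u t - x0 - x0^2 * Bt t\<bar> \<le> 10 * M^2 * \<bar>x0\<bar>^3"
proof -
  let ?d = "1 / x0 - 1 / u t"
  \<comment> \<open>Writing the factor \<open>u t\<close> in \<open>u_diff\<close> as
    \<open>x0 + (u t - x0)\<close> isolates the leading term.\<close>
  have "u t - x0 - x0^2 * Bt t = x0 * (u t - x0) * ?d + x0^2 * (?d - Bt t)"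
    using u_diff[OF t] by (simp add: algebra_simps power2_eq_square)
  then have "\<bar>u t - x0 - x0^2 * Bt t\<bar> \<le> \<bar>x0 * (u t - x0) * ?d\<bar> + \<bar>x0^2 * (?d - Bt t)\<bar>"
    by (simp only: abs_triangle_ineq)
  also have "\<dots> \<le> \<bar>x0\<bar> * (4 * M * x0^2) * (2 * M) + x0^2 * (2 * M * \<bar>x0\<bar>)"
    unfolding abs_mult using expansion_first[OF t] reciprocal_diff_bound[OF t] M(1)
    by (intro add_mono mult_mono) auto
  also have "\<dots> = 8 * M^2 * \<bar>x0\<bar>^3 + 2 * M * \<bar>x0\<bar>^3"
    by (simp add: abs_powers power2_eq_square[of M])
  also have "\<dots> \<le> 8 * M^2 * \<bar>x0\<bar>^3 + 2 * M^2 * \<bar>x0\<bar>^3"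
    using M(1) by (intro add_left_mono mult_right_mono) (auto simp: power2_eq_square)
  finally show ?thesis by simp
qed

text \<open>\<open>expansion_second\<close> is inserted into \<open>reciprocal_diff\<close> at time
  1. The resulting quadratic in \<open>x0\<close> governs both the center conditions and the two
  orbits of the example.\<close>

lemma displacement_expansion:
  "\<bar>(1 / x0 - 1 / u 1) - (Bt 1 + x0 * integral {0..1} A + x0^2 * integral {0..1} (\<lambda>t. A t * Bt t))\<bar>
    \<le> 10 * M^3 * \<bar>x0\<bar>^3"
proof -
  have "\<bar>A t * (u t - x0 - x0^2 * Bt t)\<bar> \<le> 10 * M^3 * \<bar>x0\<bar>^3" if t: "t \<in> {0..1}" for t
  proof -
    have "\<bar>A t * (u t - x0 - x0^2 * Bt t)\<bar> \<le> M * (10 * M^2 * \<bar>x0\<bar>^3)"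
      unfolding abs_mult using M(1) M(2)[OF t] expansion_second[OF t] by (intro mult_mono) auto
    then show ?thesis by (simp add: power2_eq_square[of M] power3_eq_cube[of M])
  qed
  then have "\<bar>integral {0..1} (\<lambda>t. A t * (u t - x0 - x0^2 * Bt t))\<bar> \<le> 10 * M^3 * \<bar>x0\<bar>^3"
    by (intro abs_integral_le continuous_intros contA sol_cont[OF sol] Bt_cont) auto
  also have "integral {0..1} (\<lambda>t. A t * (u t - x0 - x0^2 * Bt t)) =
    integral {0..1} (\<lambda>t. A t * u t - x0 * A t - x0^2 * (A t * Bt t))"
    by (simp add: algebra_simps)
  also have "\<dots> = integral {0..1} (\<lambda>t. A t * u t) - x0 * integral {0..1} A
      - x0^2 * integral {0..1} (\<lambda>t. A t * Bt t)"
    by (intro integral_diff2 continuous_intros contA sol_cont[OF sol] Bt_cont)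
  finally show ?thesis
    using reciprocal_diff[of 1] by (simp add: algebra_simps)
qed

text \<open>On a periodic orbit this integral is the logarithm of the derivative of the Poincare
  map. The approximation is x0^2 times the derivative of the quadratic in
  \<open>displacement_expansion\<close>.\<close>

lemma square_expansion:
  "\<bar>integral {0..1} (\<lambda>t. A t * (u t)^2)
     - (x0^2 * integral {0..1} A + 2 * x0^3 * integral {0..1} (\<lambda>t. A t * Bt t))\<bar> \<le> 36 * M^3 * x0^4"
proof -
  have "\<bar>A t * ((u t)^2 - x0^2 - 2 * x0^3 * Bt t)\<bar> \<le> 36 * M^3 * x0^4" if t: "t \<in> {0..1}" for t
  proof -
    have "(u t)^2 - x0^2 - 2 * x0^3 * Bt t = (u t - x0)^2 + 2 * x0 * (u t - x0 - x0^2 * Bt t)"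
      by (simp add: power2_eq_square power3_eq_cube algebra_simps)
    moreover have "\<bar>(u t - x0)^2\<bar> \<le> (4 * M * x0^2)^2"
      using power_mono[OF expansion_first[OF t], of 2] by simp
    moreover have "\<bar>2 * x0 * (u t - x0 - x0^2 * Bt t)\<bar> \<le> 2 * \<bar>x0\<bar> * (10 * M^2 * \<bar>x0\<bar>^3)"
      unfolding abs_mult using expansion_second[OF t] by (intro mult_mono) auto
    moreover have "2 * \<bar>x0\<bar> * (10 * M^2 * \<bar>x0\<bar>^3) = 20 * M^2 * x0^4"
      by (simp add: abs_powers)
    moreover have "(4 * M * x0^2)^2 = 16 * M^2 * x0^4"
      by (simp add: power2_eq_square power4_eq_xxxx)
    ultimately have "\<bar>(u t)^2 - x0^2 - 2 * x0^3 * Bt t\<bar> \<le> 36 * M^2 * x0^4" by linarith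
    then have "\<bar>A t * ((u t)^2 - x0^2 - 2 * x0^3 * Bt t)\<bar> \<le> M * (36 * M^2 * x0^4)"
      unfolding abs_mult using M(1) M(2)[OF t] by (intro mult_mono) auto
    then show ?thesis by (simp add: power2_eq_square[of M] power3_eq_cube[of M])
  qed
  then have "\<bar>integral {0..1} (\<lambda>t. A t * ((u t)^2 - x0^2 - 2 * x0^3 * Bt t))\<bar> \<le> 36 * M^3 * x0^4"
    by (intro abs_integral_le continuous_intros contA sol_cont[OF sol] Bt_cont) auto
  also have "integral {0..1} (\<lambda>t. A t * ((u t)^2 - x0^2 - 2 * x0^3 * Bt t)) =
    integral {0..1} (\<lambda>t. A t * (u t)^2 - x0^2 * A t - 2 * x0^3 * (A t * Bt t))"
    by (simp add: algebra_simps)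
  also have "\<dots> = integral {0..1} (\<lambda>t. A t * (u t)^2) - x0^2 * integral {0..1} A
      - 2 * x0^3 * integral {0..1} (\<lambda>t. A t * Bt t)"
    by (intro integral_diff2 continuous_intros contA sol_cont[OF sol] Bt_cont)
  finally show ?thesis by (simp add: algebra_simps)
qed

end

text \<open>Letting x tend to 0 from the right removes the constant term; division by x then gives
  the same situation for the next coefficient.\<close>

lemma small_quadratic_zero:
  fixes a b c :: real
  assumes "0 < \<delta>" and le: "\<And>x. 0 < x \<Longrightarrow> x < \<delta> \<Longrightarrow> \<bar>a + x * b + x^2 * c\<bar> \<le> C * \<bar>x\<bar>^3"
  shows "a = 0" "b = 0" "c = 0"
proof -
  have ev: "\<forall>\<^sub>F x in at_right (0::real). 0 < x \<and> x < \<delta>"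
    using assms(1) by (auto simp: eventually_at_right)
  have "((\<lambda>x. a + x * b + x^2 * c) \<longlongrightarrow> 0) (at_right 0)"
  proof (rule Lim_null_comparison)
    show "((\<lambda>x::real. C * x^3) \<longlongrightarrow> 0) (at_right 0)" by (rule tendsto_eq_intros refl)+ simp
    show "\<forall>\<^sub>F x in at_right 0. norm (a + x * b + x^2 * c) \<le> C * x^3"
      using ev by eventually_elim (use le in force)
  qed
  moreover have "((\<lambda>x. a + x * b + x^2 * c) \<longlongrightarrow> a) (at_right 0)" by (rule tendsto_eq_intros refl)+ simp
  ultimately show a: "a = 0" using tendsto_unique trivial_limit_at_right_real by blast
  have le2: "\<bar>b + x * c\<bar> \<le> C * x^2" if "0 < x" "x < \<delta>" for x
  proof -
    have "x * \<bar>b + x * c\<bar> = \<bar>x * (b + x * c)\<bar>" using that by (simp add: abs_mult)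
    also have "\<dots> \<le> x * (C * x^2)"
      using le[OF that] a that by (simp add: power2_eq_square power3_eq_cube algebra_simps)
    finally show ?thesis using that by simp
  qed
  have "((\<lambda>x. b + x * c) \<longlongrightarrow> 0) (at_right 0)"
  proof (rule Lim_null_comparison)
    show "((\<lambda>x::real. C * x^2) \<longlongrightarrow> 0) (at_right 0)" by (rule tendsto_eq_intros refl)+ simp
    show "\<forall>\<^sub>F x in at_right 0. norm (b + x * c) \<le> C * x^2"
      using ev by eventually_elim (use le2 in force)
  qed
  moreover have "((\<lambda>x. b + x * c) \<longlongrightarrow> b) (at_right 0)" by (rule tendsto_eq_intros refl)+ simp
  ultimately show b: "b = 0" using tendsto_unique trivial_limit_at_right_real by blast
  have le3: "\<bar>c\<bar> \<le> C * x" if "0 < x" "x < \<delta>" for x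
    using le2[OF that] b that by (simp add: abs_mult power2_eq_square)
  have "((\<lambda>x::real. c) \<longlongrightarrow> 0) (at_right 0)"
  proof (rule Lim_null_comparison)
    show "((\<lambda>x::real. C * x) \<longlongrightarrow> 0) (at_right 0)" by (rule tendsto_eq_intros refl)+ simp
    show "\<forall>\<^sub>F x in at_right (0::real). norm c \<le> C * x"
      using ev by eventually_elim (use le3 in force)
  qed
  then show "c = 0" using tendsto_const_iff trivial_limit_at_right_real by metis
qed

text \<open>For periodic orbits the displacement 1/x - 1/u(1) vanishes, so the quadratic is O(x^3)
  for small positive x.\<close>

lemma (in abel) center_imp_integrals_zero:
  assumes center: "has_center A B 0"
    and Bt: "\<And>t. t \<in> {0..1} \<Longrightarrow> (Bt has_real_derivative B t) (at t within {0..1})" "Bt 0 = 0"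
  shows "Bt 1 = 0" "integral {0..1} A = 0" "integral {0..1} (\<lambda>t. A t * Bt t) = 0"
proof -
  obtain M where M: "M \<ge> 1" "\<And>t. t \<in> {0..1} \<Longrightarrow> \<bar>A t\<bar> \<le> M" "\<And>t. t \<in> {0..1} \<Longrightarrow> \<bar>B t\<bar> \<le> M"
    using bounded_coeffs by blast
  obtain \<epsilon> where eps: "0 < \<epsilon>" "\<And>x. \<bar>x\<bar> < \<epsilon> \<Longrightarrow> periodic_orbit A B x"
    using center by (auto simp: has_center_def)
  have "\<bar>Bt 1 + x * integral {0..1} A + x^2 * integral {0..1} (\<lambda>t. A t * Bt t)\<bar> \<le> 10 * M^3 * \<bar>x\<bar>^3"
    if x: "0 < x" "x < min \<epsilon> (1 / (16 * M))" for x
  proof -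
    obtain u where u: "abel_sol A B x u" "u 1 = x"
      using eps(2)[of x] x by (auto simp: periodic_orbit_def)
    interpret abel_small A B M x u Bt
      by unfold_locales (use M x u Bt in auto)
    show ?thesis using displacement_expansion u(2) by simp
  qed
  moreover have "0 < min \<epsilon> (1 / (16 * M))" using eps(1) M(1) by simp
  ultimately show "Bt 1 = 0" "integral {0..1} A = 0" "integral {0..1} (\<lambda>t. A t * Bt t) = 0"
    using small_quadratic_zero by blast+
qed

subsection \<open>Separable equations\<close>

text \<open>Separation of variables: if G is a primitive of 1/(a x^3 + b x^2) on the range of u,
  then G o u has derivative C. G is injective there by Rolle's theorem.\<close>

lemma separable_return:
  fixes a b :: real
  assumes C: "continuous_on {0..1} C"
    and u: "abel_sol (\<lambda>t. a * C t) (\<lambda>t. b * C t) x0 u"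
    and nz: "\<And>t. t \<in> {0..1} \<Longrightarrow> a * (u t)^3 + b * (u t)^2 \<noteq> 0"
  shows "u 1 = x0 \<longleftrightarrow> integral {0..1} C = 0"
proof -
  interpret abel "\<lambda>t. a * C t" "\<lambda>t. b * C t"
    by unfold_locales (intro continuous_intros C)+
  define p where "p x = a * x^3 + b * x^2" for x
  obtain c d where cd: "u ` {0..1} = {c..d}" "c \<le> d"
    using continuous_image_closed_interval[OF zero_le_one sol_cont[OF u]] by blast
  have p: "p x \<noteq> 0" if "x \<in> {c..d}" for x
    using that nz unfolding cd(1)[symmetric] p_def by blast
  have "continuous_on {c..d} (\<lambda>x. 1 / p x)"
    using p unfolding p_def by (intro continuous_intros) auto
  then obtain G where G: "\<And>x. x \<in> {c..d} \<Longrightarrow> (G has_vector_derivative 1 / p x) (at x within {c..d})"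
    using antiderivative_continuous by blast
  have G': "(G has_real_derivative 1 / p x) (at x within {c..d})" if "x \<in> {c..d}" for x
    using G[OF that] by (simp add: has_real_derivative_iff_has_vector_derivative)
  have "(G \<circ> u has_real_derivative C t) (at t within {0..1})" if t: "t \<in> {0..1}" for t
  proof -
    have "u t \<in> {c..d}" using t cd(1) by blast
    then have "(G has_real_derivative 1 / p (u t)) (at (u t) within u ` {0..1})"
      using G' cd(1) by simp
    from DERIV_image_chain[OF this sol_deriv[OF u t]]
    have "(G \<circ> u has_real_derivative 1 / p (u t) * (a * C t * u t ^ 3 + b * C t * (u t)\<^sup>2)) (at t within {0..1})" .
    also have "1 / p (u t) * (a * C t * u t ^ 3 + b * C t * (u t)\<^sup>2) = C t"
      using nz[OF t] by (simp add: p_def field_simps)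
    finally show ?thesis .
  qed
  from integral_unique[OF integral_derivative[OF this, of 1]]
  have int: "integral {0..1} C = G (u 1) - G (u 0)" by simp
  have inj: "x = y" if xy: "G x = G y" "x \<in> {c..d}" "y \<in> {c..d}" for x y
  proof (rule ccontr)
    assume "x \<noteq> y"
    then consider "x < y" | "y < x" by linarith
    then show False
    proof cases
      case 1
      obtain z where "x < z" "z < y" "1 / p z = 0"
        by (rule rolle_within[OF G', of x y]) (use 1 xy in auto)
      then show ?thesis using p[of z] xy by auto
    next
      case 2
      obtain z where "y < z" "z < x" "1 / p z = 0"
        by (rule rolle_within[OF G', of y x]) (use 2 xy in auto)
      then show ?thesis using p[of z] xy by auto
    qed
  qed
  have "u 1 \<in> {c..d}" "u 0 \<in> {c..d}" unfolding cd(1)[symmetric] by auto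
  then show ?thesis using int inj[of "u 1" "u 0"] sol_init[OF u] by auto
qed

text \<open>The zeros of a x^3 + b x^2 are constant solutions, which no other solution can
  meet.\<close>

lemma (in abel) separable_nonzero:
  assumes AB: "A = (\<lambda>t. a * C t)" "B = (\<lambda>t. b * C t)"
    and u: "abel_sol A B x0 u" and nz: "x0 \<noteq> 0" "a * x0 + b \<noteq> 0" and t: "t \<in> {0..1}"
  shows "a * (u t)^3 + b * (u t)^2 \<noteq> 0"
proof -
  have "a * u t + b \<noteq> 0"
  proof (cases "a = 0")
    case True
    then show ?thesis using nz by simp
  next
    case False
    have "abel_sol A B (- (b / a)) (\<lambda>_. - (b / a))"
      unfolding abel_sol_def AB using False by (auto simp: field_simps power2_eq_square power3_eq_cube)
    moreover have "x0 \<noteq> - (b / a)" using False nz by (auto simp: field_simps)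
    ultimately have "u t \<noteq> - (b / a)" using sol_distinct[OF u _ _ t] by blast
    then show ?thesis using False by (auto simp: field_simps)
  qed
  moreover have "a * (u t)^3 + b * (u t)^2 = (u t)^2 * (a * u t + b)"
    by (simp add: power2_eq_square power3_eq_cube algebra_simps)
  ultimately show ?thesis using sol_nonzero[OF u nz(1) t] by simp
qed

lemma (in abel) separable_center:
  assumes C: "continuous_on {0..1} C" and int: "integral {0..1} C = 0"
    and AB: "A = (\<lambda>t. a * C t)" "B = (\<lambda>t. b * C t)"
  shows "has_center A B 0"
proof -
  obtain M where M: "M \<ge> 1" "\<And>t. t \<in> {0..1} \<Longrightarrow> \<bar>A t\<bar> \<le> M" "\<And>t. t \<in> {0..1} \<Longrightarrow> \<bar>B t\<bar> \<le> M"
    using bounded_coeffs by blast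
  have "periodic_orbit A B x0" if small: "\<bar>x0 - 0\<bar> < 1 / (16 * M)" for x0
  proof (cases "x0 = 0 \<or> a * x0 + b = 0")
    case True
    then have "a * x0^3 + b * x0^2 = 0"
      by (auto simp: power2_eq_square power3_eq_cube) (metis distrib_left mult.assoc mult.commute mult_zero_left)
    then have "a * C t * x0^3 + b * C t * x0^2 = 0" for t
      by (metis distrib_left mult.assoc mult.commute mult_zero_left)
    then have "abel_sol A B x0 (\<lambda>_. x0)" unfolding abel_sol_def AB by auto
    then show ?thesis unfolding periodic_orbit_def by blast
  next
    case False
    obtain u where u: "abel_sol A B x0 u"
      using small_solution_exists[OF M, of x0] small by auto
    have "u 1 = x0"
      using separable_return[OF C u[unfolded AB]] separable_nonzero[OF AB u] False int by blast
    then show ?thesis using u unfolding periodic_orbit_def by blast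
  qed
  moreover have "0 < 1 / (16 * M)" using M(1) by simp
  moreover have "periodic_orbit A B 0" using sol_zero unfolding periodic_orbit_def by blast
  ultimately show ?thesis unfolding has_center_def by blast
qed

subsection \<open>Combinations without zeros\<close>

context abel
begin

text \<open>At time 1 this is the logarithm of the derivative of the Poincare map, so a periodic
  orbit is hyperbolic if it is nonzero there.\<close>

definition var_integral :: "(real \<Rightarrow> real) \<Rightarrow> real \<Rightarrow> real" where
  "var_integral u t = integral {0..t} (\<lambda>t. 3 * A t * (u t)^2 + 2 * B t * u t)"

lemma var_integral_deriv:
  assumes u: "abel_sol A B x0 u" and t: "t \<in> {0..1}"
  shows "(var_integral u has_real_derivative 3 * A t * (u t)^2 + 2 * B t * u t) (at t within {0..1})"
  unfolding var_integral_def
  by (rule integral_has_real_derivative[OF _ t]) (intro continuous_intros contA contB sol_cont[OF u])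

lemma var_integral_0 [simp]: "var_integral u 0 = 0"
  by (simp add: var_integral_def)

text \<open>With w = 1/u one has (w^2/2)' = - A - B w, so A cancels in the difference of two
  solutions and Rolle's theorem makes them meet.\<close>

lemma periodic_unique_if_B_nonzero:
  assumes B: "\<And>t. 0 < t \<Longrightarrow> t < 1 \<Longrightarrow> B t \<noteq> 0"
    and u: "abel_sol A B x u" "u 1 = x" "x \<noteq> 0" and v: "abel_sol A B y v" "v 1 = y" "y \<noteq> 0"
  shows "x = y"
proof (rule ccontr)
  assume neq: "x \<noteq> y"
  let ?f = "\<lambda>t. ((1 / u t)^2 - (1 / v t)^2) / 2"
  have f: "(?f has_real_derivative - B t * (1 / u t - 1 / v t)) (at t within {0..1})" if t: "t \<in> {0..1}" for t
    using sol_nonzero[OF u(1,3) t] sol_nonzero[OF v(1,3) t]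
    by (intro DERIV_cong[OF DERIV_cdivide[OF DERIV_diff[OF DERIV_power[OF reciprocal_deriv[OF u(1,3) t]]
          DERIV_power[OF reciprocal_deriv[OF v(1,3) t]]]]])
      (simp add: field_simps)
  obtain s where s: "0 < s" "s < 1" "- B s * (1 / u s - 1 / v s) = 0"
    by (rule rolle_within[OF f, of 0 1]) (use u(2) v(2) sol_init[OF u(1)] sol_init[OF v(1)] in auto)
  then have "1 / u s = 1 / v s" using B[of s] by auto
  then show False using sol_distinct[OF u(1) v(1) neq, of s] s by auto
qed

text \<open>Subtracting 3 ln |u|, which is unchanged over a period, reduces the exponent to - B u,
  which has no zero in (0,1).\<close>

lemma hyperbolic_if_B_nonzero:
  assumes B: "\<And>t. 0 < t \<Longrightarrow> t < 1 \<Longrightarrow> B t \<noteq> 0"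
    and u: "abel_sol A B x u" "u 1 = x" "x \<noteq> 0"
  shows "hyperbolic_orbit A B x"
proof (rule hyperbolicI[OF u(1,2)], fold var_integral_def, rule notI)
  assume zero: "var_integral u 1 = 0"
  let ?f = "\<lambda>t. var_integral u t - 3 * (ln ((u t)^2) / 2)"
  have f: "(?f has_real_derivative - B t * u t) (at t within {0..1})" if t: "t \<in> {0..1}" for t
    by (rule DERIV_cong[OF DERIV_diff[OF var_integral_deriv[OF u(1) t] DERIV_cmult[OF log_deriv[OF u(1,3) t]]]])
      (simp add: algebra_simps)
  obtain s where "0 < s" "s < 1" "- B s * u s = 0"
    by (rule rolle_within[OF f, of 0 1]) (use u(2) zero sol_init[OF u(1)] in auto)
  then show False using B[of s] sol_nonzero[OF u(1,3), of s] by auto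
qed

text \<open>For z = 1/u - \<beta> and C = A + \<beta> B one has z' = - B u z - u C. The integrating
  factor of this linear equation gives a strictly monotone multiple of z. The result makes ln |z|
  available.\<close>

lemma shifted_reciprocal_nonzero:
  assumes C: "\<And>t. 0 < t \<Longrightarrow> t < 1 \<Longrightarrow> A t + \<beta> * B t \<noteq> 0"
    and u: "abel_sol A B x u" "u 1 = x" "x \<noteq> 0" and t: "t \<in> {0..1}"
  shows "1 / u t - \<beta> \<noteq> 0"
proof
  assume zt: "1 / u t - \<beta> = 0"
  have cBu: "continuous_on {0..1} (\<lambda>t. B t * u t)"
    by (intro continuous_intros contB sol_cont[OF u(1)])
  let ?e = "\<lambda>t. exp (integral {0..t} (\<lambda>t. B t * u t))"
  \<comment> \<open>\<open>m\<close> is strictly monotone, while \<open>m 0\<close> and \<open>m 1\<close> have the same sign by periodicity\<close>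
  define m where "m t = ?e t * (1 / u t - \<beta>)" for t
  have m: "(m has_real_derivative - ?e t * u t * (A t + \<beta> * B t)) (at t within {0..1})"
    if t: "t \<in> {0..1}" for t
    unfolding m_def
    by (rule derivative_eq_intros reciprocal_deriv[OF u(1,3) t] integral_has_real_derivative[OF cBu t] refl)+
      (use sol_nonzero[OF u(1,3) t] in \<open>simp add: field_simps\<close>)
  have inj: "inj_on m {0..1}"
  proof (rule linorder_inj_onI)
    fix r s :: real assume rs: "r < s" "r \<in> {0..1}" "s \<in> {0..1}"
    show "m r \<noteq> m s"
    proof
      assume "m r = m s"
      obtain q where q: "r < q" "q < s" "- ?e q * u q * (A q + \<beta> * B q) = 0"
        by (rule rolle_within[OF m, of r s]) (use rs \<open>m r = m s\<close> in auto)
      then have "0 < q" "q < 1" using rs by auto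
      then show False using q(3) C[of q] sol_nonzero[OF u(1,3), of q] by auto
    qed
  qed auto
  have m1: "m 1 = ?e 1 * m 0" using u(2) sol_init[OF u(1)] by (simp add: m_def)
  have mt: "m t = 0" using zt by (simp add: m_def)
  have "m 0 \<noteq> 0"
    using inj_onD[OF inj, of 0 1] m1 by auto
  then have "t \<noteq> 0" using mt by auto
  moreover have "t \<noteq> 1" using mt m1 \<open>m 0 \<noteq> 0\<close> by auto
  ultimately have t01: "0 < t" "t < 1" using t by auto
  have "continuous_on {0..1} m" using m by (rule DERIV_continuous_on)
  \<comment> \<open>A zero of a strictly monotone function at an interior point gives opposite signs
    at the ends.\<close>
  from continuous_inj_imp_mono[OF t01 this inj] have "m 0 * m 1 < 0"
    unfolding mt by (auto simp: mult_neg_pos mult_pos_neg)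
  moreover have "m 0 * m 1 = ?e 1 * (m 0)^2" by (simp add: m1 power2_eq_square)
  ultimately show False by (metis exp_ge_zero mult_nonneg_nonneg not_less zero_le_power2)
qed

text \<open>The term - B is common to all solutions. In the difference only the terms C/z remain,
  and they agree at a point of (0,1) only if the solutions do.\<close>

lemma periodic_unique_if_combination_nonzero:
  assumes C: "\<And>t. 0 < t \<Longrightarrow> t < 1 \<Longrightarrow> A t + \<beta> * B t \<noteq> 0"
    and u: "abel_sol A B x u" "u 1 = x" "x \<noteq> 0" and v: "abel_sol A B y v" "v 1 = y" "y \<noteq> 0"
  shows "x = y"
proof (rule ccontr)
  assume neq: "x \<noteq> y"
  define F where "F w t = 1 / w t - \<beta> + \<beta> * (ln ((1 / w t - \<beta>)^2) / 2)" for w :: "real \<Rightarrow> real" and t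
  have F: "(F w has_real_derivative - B t - (A t + \<beta> * B t) / (1 / w t - \<beta>)) (at t within {0..1})"
    if w: "abel_sol A B x0 w" "w 1 = x0" "x0 \<noteq> 0" and t: "t \<in> {0..1}" for w x0 t
  proof -
    have z: "((\<lambda>t. 1 / w t - \<beta>) has_real_derivative - (A t * w t + B t)) (at t within {0..1})"
      by (rule derivative_eq_intros reciprocal_deriv[OF w(1,3) t] refl)+ simp
    note nz = shifted_reciprocal_nonzero[OF C w t]
    define z0 where "z0 = 1 / w t - \<beta>"
    have w0: "w t \<noteq> 0" using sol_nonzero[OF w(1,3) t] .
    have one: "w t * (z0 + \<beta>) = 1" using w0 by (simp add: z0_def)
    have "- (A t * w t + B t) + \<beta> * (- (A t * w t + B t) / z0) = - B t - (A t + \<beta> * B t) / z0"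
    proof -
      have "A t * w t * (z0 + \<beta>) = A t" using one by (simp add: mult.assoc)
      then show ?thesis using nz unfolding z0_def[symmetric] by (simp add: field_simps)
    qed
    then show ?thesis
      using DERIV_add[OF z DERIV_cmult[OF log_square_deriv[OF z nz], of \<beta>]]
      by (simp only: z0_def F_def[abs_def])
  qed
  have f: "((\<lambda>t. F u t - F v t) has_real_derivative
      (A t + \<beta> * B t) / (1 / v t - \<beta>) - (A t + \<beta> * B t) / (1 / u t - \<beta>)) (at t within {0..1})"
    if t: "t \<in> {0..1}" for t
    by (rule DERIV_cong[OF DERIV_diff[OF F[OF u t] F[OF v t]]]) simp
  obtain s where s: "0 < s" "s < 1"
      "(A s + \<beta> * B s) / (1 / v s - \<beta>) - (A s + \<beta> * B s) / (1 / u s - \<beta>) = 0"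
    by (rule rolle_within[OF f, of 0 1]) (use u(2) v(2) sol_init[OF u(1)] sol_init[OF v(1)] in \<open>auto simp: F_def\<close>)
  have s': "s \<in> {0..1}" using s by auto
  have "1 / v s = 1 / u s"
    using s(3) C[OF s(1,2)] shifted_reciprocal_nonzero[OF C u s'] shifted_reciprocal_nonzero[OF C v s']
    by (simp add: frac_eq_eq)
  then show False using sol_distinct[OF u(1) v(1) neq s'] by auto
qed

lemma hyperbolic_if_combination_nonzero:
  assumes C: "\<And>t. 0 < t \<Longrightarrow> t < 1 \<Longrightarrow> A t + \<beta> * B t \<noteq> 0"
    and u: "abel_sol A B x u" "u 1 = x" "x \<noteq> 0"
  shows "hyperbolic_orbit A B x"
proof (rule hyperbolicI[OF u(1,2)], fold var_integral_def, rule notI)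
  assume zero: "var_integral u 1 = 0"
  \<comment> \<open>Both logarithms are periodic, so the increment of \<open>?f\<close> over the
    period is that of \<open>var_integral u\<close>.\<close>
  let ?f = "\<lambda>t. var_integral u t - 3 * (ln ((u t)^2) / 2) - ln ((1 / u t - \<beta>)^2) / 2"
  have f: "(?f has_real_derivative u t * (A t + \<beta> * B t) / (1 / u t - \<beta>)) (at t within {0..1})"
    if t: "t \<in> {0..1}" for t
  proof -
    have z: "((\<lambda>t. 1 / u t - \<beta>) has_real_derivative - (A t * u t + B t)) (at t within {0..1})"
      by (rule derivative_eq_intros reciprocal_deriv[OF u(1,3) t] refl)+ simp
    note nz = shifted_reciprocal_nonzero[OF C u t]
    define z0 where "z0 = 1 / u t - \<beta>"
    have one: "u t * z0 = 1 - \<beta> * u t"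
      using sol_nonzero[OF u(1,3) t] by (simp add: z0_def field_simps)
    have "3 * A t * (u t)^2 + 2 * B t * u t - 3 * (A t * (u t)^2 + B t * u t) - (- (A t * u t + B t)) / z0
      = u t * (A t + \<beta> * B t) / z0"
    proof -
      have "B t * (u t * z0) = B t - \<beta> * B t * u t" unfolding one by (simp add: algebra_simps)
      then show ?thesis using nz unfolding z0_def[symmetric] by (simp add: field_simps)
    qed
    then show ?thesis
      using DERIV_diff[OF DERIV_diff[OF var_integral_deriv[OF u(1) t] DERIV_cmult[OF log_deriv[OF u(1,3) t], of 3]]
          log_square_deriv[OF z nz]]
      by (simp add: z0_def)
  qed
  obtain s where s: "0 < s" "s < 1" "u s * (A s + \<beta> * B s) / (1 / u s - \<beta>) = 0"
    by (rule rolle_within[OF f, of 0 1]) (use u(2) zero sol_init[OF u(1)] in auto)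
  have s': "s \<in> {0..1}" using s by auto
  show False
    using s(3) C[OF s(1,2)] sol_nonzero[OF u(1,3) s'] shifted_reciprocal_nonzero[OF C u s'] by auto
qed

lemma combination_nonzero:
  assumes "\<And>t. 0 < t \<Longrightarrow> t < 1 \<Longrightarrow> \<alpha> * A t + \<beta> * B t \<noteq> 0"
  shows "\<And>x y. x \<noteq> 0 \<Longrightarrow> y \<noteq> 0 \<Longrightarrow> periodic_orbit A B x \<Longrightarrow> periodic_orbit A B y \<Longrightarrow> x = y"
    and "\<And>x. x \<noteq> 0 \<Longrightarrow> periodic_orbit A B x \<Longrightarrow> hyperbolic_orbit A B x"
proof -
  have "(x \<noteq> 0 \<longrightarrow> y \<noteq> 0 \<longrightarrow> periodic_orbit A B x \<longrightarrow> periodic_orbit A B y \<longrightarrow> x = y)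
      \<and> (x \<noteq> 0 \<longrightarrow> periodic_orbit A B x \<longrightarrow> hyperbolic_orbit A B x)" for x y
  proof (cases "\<alpha> = 0")
    case True
    then have "B t \<noteq> 0" if "0 < t" "t < 1" for t using assms[OF that] by auto
    then show ?thesis
      unfolding periodic_orbit_def using periodic_unique_if_B_nonzero hyperbolic_if_B_nonzero by blast
  next
    case False
    then have "A t + \<beta> / \<alpha> * B t \<noteq> 0" if "0 < t" "t < 1" for t
      using assms[OF that] by (auto simp: field_simps)
    then show ?thesis
      unfolding periodic_orbit_def
      using periodic_unique_if_combination_nonzero hyperbolic_if_combination_nonzero by blast
  qed
  then show "\<And>x y. x \<noteq> 0 \<Longrightarrow> y \<noteq> 0 \<Longrightarrow> periodic_orbit A B x \<Longrightarrow> periodic_orbit A B y \<Longrightarrow> x = y"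
    and "\<And>x. x \<noteq> 0 \<Longrightarrow> periodic_orbit A B x \<Longrightarrow> hyperbolic_orbit A B x"
    by blast+
qed

text \<open>By \<open>separable_return\<close> only the constant solution x = - b/a can be periodic;
  along it the exponent is a x^2 times the integral of C.\<close>

lemma separable_periodic:
  assumes C: "continuous_on {0..1} C" and int: "integral {0..1} C \<noteq> 0"
    and AB: "A = (\<lambda>t. a * C t)" "B = (\<lambda>t. b * C t)" and ab: "a \<noteq> 0 \<or> b \<noteq> 0"
    and x: "x \<noteq> 0" "periodic_orbit A B x"
  shows "a \<noteq> 0 \<and> x = - b / a \<and> hyperbolic_orbit A B x"
proof -
  obtain u where u: "abel_sol A B x u" "u 1 = x"
    using x(2) unfolding periodic_orbit_def by blast
  have eq: "a * x + b = 0"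
    using separable_return[OF C u(1)[unfolded AB]] separable_nonzero[OF AB u(1) x(1)] u(2) int by blast
  then have a: "a \<noteq> 0" using ab by auto
  have b: "b = - a * x" using eq by simp
  have const: "abel_sol A B x (\<lambda>_. x)"
    unfolding abel_sol_def AB b by (auto simp: power2_eq_square power3_eq_cube)
  have "integral {0..1} (\<lambda>t. 3 * A t * x^2 + 2 * B t * x) = integral {0..1} (\<lambda>t. a * x^2 * C t)"
    unfolding AB b by (simp add: algebra_simps power2_eq_square)
  also have "\<dots> = a * x^2 * integral {0..1} C" by simp
  finally have "hyperbolic_orbit A B x"
    using hyperbolicI[OF const] a x(1) int by simp
  then show ?thesis using a b by simp
qed

end

subsection \<open>Trinomials\<close>

lemma trin_cont: "continuous_on S (trin j k c0 c1 c2)"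
  unfolding trin_def by (intro continuous_intros)

lemma abel_trin: "abel (trin j k a0 a1 a2) (trin j k b0 b1 b2)"
  by unfold_locales (rule trin_cont)+

lemma monomial_deriv:
  "((\<lambda>t. c / (real n + 1) * t ^ (n + 1)) has_real_derivative c * t ^ n) (at t within S)"
proof (rule DERIV_cong[OF DERIV_cmult[OF DERIV_pow]])
  have "real (n + 1) = real n + 1" "real n + 1 \<noteq> 0" by simp_all
  then show "c / (real n + 1) * (real (n + 1) * t ^ (n + 1 - Suc 0)) = c * t ^ n"
    by (simp only:) simp
qed

lemma monomial_integral: "((\<lambda>t. c * t ^ n) has_integral c / (real n + 1)) {0..1::real}"
proof -
  have "((\<lambda>t. c * t ^ n) has_integral (c / (real n + 1) * 1 ^ (n + 1) - c / (real n + 1) * 0 ^ (n + 1))) {0..1}"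
    by (rule integral_derivative[OF monomial_deriv]) simp
  then show ?thesis by simp
qed

lemma trin_integral:
  "integral {0..1} (trin j k c0 c1 c2) = c0 + c1 / (real j + 1) + c2 / (real k + 1)"
proof (rule integral_unique)
  have "((\<lambda>t. c0 * t ^ 0 + c1 * t ^ j + c2 * t ^ k) has_integral
      c0 / (real 0 + 1) + c1 / (real j + 1) + c2 / (real k + 1)) {0..1}"
    by (intro has_integral_add monomial_integral)
  then show "(trin j k c0 c1 c2 has_integral c0 + c1 / (real j + 1) + c2 / (real k + 1)) {0..1}"
    by (simp add: trin_def[abs_def])
qed

definition trin_prim :: "nat \<Rightarrow> nat \<Rightarrow> real \<Rightarrow> real \<Rightarrow> real \<Rightarrow> real \<Rightarrow> real" where
  "trin_prim j k c0 c1 c2 t = c0 * t + c1 / (real j + 1) * t ^ (j + 1) + c2 / (real k + 1) * t ^ (k + 1)"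

lemma trin_prim_deriv:
  "(trin_prim j k c0 c1 c2 has_real_derivative trin j k c0 c1 c2 t) (at t within S)"
  unfolding trin_prim_def[abs_def] trin_def
  by (intro DERIV_add monomial_deriv DERIV_cmult_Id)

lemma trin_prim_0 [simp]: "trin_prim j k c0 c1 c2 0 = 0"
  by (simp add: trin_prim_def)

lemma trin_prim_1: "trin_prim j k c0 c1 c2 1 = c0 + c1 / (real j + 1) + c2 / (real k + 1)"
  by (simp add: trin_prim_def)

text \<open>The coefficient of x0^2 in the displacement expansion, from the nine products of
  monomials.\<close>

lemma trin_moment:
  "integral {0..1} (\<lambda>t. trin j k a0 a1 a2 t * trin_prim j k b0 b1 b2 t) =
     a0 * b0 / 2 + a0 * b1 / ((real j + 1) * (real j + 2)) + a0 * b2 / ((real k + 1) * (real k + 2))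
   + (a1 * b0 / (real j + 2) + a1 * b1 / ((real j + 1) * (2 * real j + 2))
      + a1 * b2 / ((real k + 1) * (real j + real k + 2)))
   + (a2 * b0 / (real k + 2) + a2 * b1 / ((real j + 1) * (real j + real k + 2))
      + a2 * b2 / ((real k + 1) * (2 * real k + 2)))"
proof (rule integral_unique)
  let ?f = "\<lambda>t::real. (a0 * b0) * t ^ 1 + (a0 * b1 / (real j + 1)) * t ^ (j + 1)
      + (a0 * b2 / (real k + 1)) * t ^ (k + 1)
    + ((a1 * b0) * t ^ (j + 1) + (a1 * b1 / (real j + 1)) * t ^ (j + j + 1)
      + (a1 * b2 / (real k + 1)) * t ^ (j + k + 1))
    + ((a2 * b0) * t ^ (k + 1) + (a2 * b1 / (real j + 1)) * t ^ (j + k + 1)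
      + (a2 * b2 / (real k + 1)) * t ^ (k + k + 1))"
  have *: "(?f has_integral
     a0 * b0 / (real 1 + 1) + a0 * b1 / (real j + 1) / (real (j + 1) + 1) + a0 * b2 / (real k + 1) / (real (k + 1) + 1)
   + (a1 * b0 / (real (j + 1) + 1) + a1 * b1 / (real j + 1) / (real (j + j + 1) + 1)
      + a1 * b2 / (real k + 1) / (real (j + k + 1) + 1))
   + (a2 * b0 / (real (k + 1) + 1) + a2 * b1 / (real j + 1) / (real (j + k + 1) + 1)
      + a2 * b2 / (real k + 1) / (real (k + k + 1) + 1))) {0..1}"
    by (intro has_integral_add monomial_integral)
  have "?f = (\<lambda>t. trin j k a0 a1 a2 t * trin_prim j k b0 b1 b2 t)"
    by (rule ext) (simp add: trin_def trin_prim_def power_add algebra_simps add_divide_distrib)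
  with * show "((\<lambda>t. trin j k a0 a1 a2 t * trin_prim j k b0 b1 b2 t) has_integral
     a0 * b0 / 2 + a0 * b1 / ((real j + 1) * (real j + 2)) + a0 * b2 / ((real k + 1) * (real k + 2))
   + (a1 * b0 / (real j + 2) + a1 * b1 / ((real j + 1) * (2 * real j + 2))
      + a1 * b2 / ((real k + 1) * (real j + real k + 2)))
   + (a2 * b0 / (real k + 2) + a2 * b1 / ((real j + 1) * (real j + real k + 2))
      + a2 * b2 / ((real k + 1) * (2 * real k + 2)))) {0..1}"
    by (simp add: algebra_simps)
qed

text \<open>For zero means, integration by parts shows that the moment is antisymmetric in the two
  trinomials, hence a multiple of this minor. Direct elimination of \<open>a0\<close> and
  \<open>b0\<close> yields the factor, which is nonzero for 0 < j < k.\<close>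

lemma trin_moment_zero_mean:
  assumes a: "a0 + a1 / (real j + 1) + a2 / (real k + 1) = 0"
    and b: "b0 + b1 / (real j + 1) + b2 / (real k + 1) = 0"
  shows "integral {0..1} (\<lambda>t. trin j k a0 a1 a2 t * trin_prim j k b0 b1 b2 t) =
    (a2 * b1 - a1 * b2) * (real j * real k * (real k - real j)) /
      (2 * (real j + 1) * (real j + 2) * (real k + 1) * (real k + 2) * (real j + real k + 2))"
proof -
  define J K where "J = real j" and "K = real k"
  have pos: "0 \<le> J" "0 \<le> K" by (simp_all add: J_def K_def)
  then have nz: "J + 1 \<noteq> 0" "J + 2 \<noteq> 0" "K + 1 \<noteq> 0" "K + 2 \<noteq> 0" "J + K + 2 \<noteq> 0" "2 * J + 2 \<noteq> 0" "2 * K + 2 \<noteq> 0"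
    by auto
  have a0: "a0 = - a1 / (J + 1) - a2 / (K + 1)" and b0: "b0 = - b1 / (J + 1) - b2 / (K + 1)"
    using a b by (simp_all add: J_def K_def)
  show ?thesis
    unfolding trin_moment J_def[symmetric] K_def[symmetric] a0 b0 using nz
    by (simp add: divide_simps) algebra
qed

text \<open>Vanishing minors mean linear dependence. The normalisation of \<open>a\<close> and
  \<open>b\<close> ensures that at least one of the two trinomials is the common factor
  itself.\<close>

lemma proportional_coefficients:
  fixes a0 a1 a2 b0 b1 b2 :: real
  assumes "a2 * b1 - a1 * b2 = 0" "a0 * b2 - a2 * b0 = 0" "a1 * b0 - a0 * b1 = 0"
  obtains a b c0 c1 c2 where "a = 1 \<or> a = 0 \<and> b = (1::real)"
    "a0 = a * c0" "a1 = a * c1" "a2 = a * c2" "b0 = b * c0" "b1 = b * c1" "b2 = b * c2"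
proof -
  consider "a0 = 0 \<and> a1 = 0 \<and> a2 = 0" | "a0 \<noteq> 0" | "a1 \<noteq> 0" | "a2 \<noteq> 0" by blast
  then show ?thesis
  proof cases
    case 1 then show ?thesis using that[of 0 1 b0 b1 b2] by simp
  next
    case 2 then show ?thesis using that[of 1 "b0 / a0" a0 a1 a2] assms by (simp add: field_simps)
  next
    case 3 then show ?thesis using that[of 1 "b1 / a1" a0 a1 a2] assms by (simp add: field_simps)
  next
    case 4 then show ?thesis using that[of 1 "b2 / a2" a0 a1 a2] assms by (simp add: field_simps)
  qed
qed

lemma trin_scale: "trin j k (a * c0) (a * c1) (a * c2) = (\<lambda>t. a * trin j k c0 c1 c2 t)"
  by (rule ext) (simp add: trin_def algebra_simps)

lemma trin_center_iff:
  assumes jk: "0 < j" "j < k"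
  shows "has_center (trin j k a0 a1 a2) (trin j k b0 b1 b2) 0 \<longleftrightarrow>
     (a0 + a1 / (real j + 1) + a2 / (real k + 1) = 0 \<and>
      b0 + b1 / (real j + 1) + b2 / (real k + 1) = 0 \<and>
      a2 * b1 - a1 * b2 = 0)"
proof
  interpret abel "trin j k a0 a1 a2" "trin j k b0 b1 b2" by (rule abel_trin)
  assume c: "has_center (trin j k a0 a1 a2) (trin j k b0 b1 b2) 0"
  note z = center_imp_integrals_zero[OF c trin_prim_deriv trin_prim_0]
  have a: "a0 + a1 / (real j + 1) + a2 / (real k + 1) = 0" using z(2) by (simp add: trin_integral)
  have b: "b0 + b1 / (real j + 1) + b2 / (real k + 1) = 0" using z(1) by (simp add: trin_prim_1)
  have "real k \<noteq> real j" "real j \<noteq> 0" "real k \<noteq> 0" "real j + 1 \<noteq> 0" "real j + 2 \<noteq> 0"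
    "real k + 1 \<noteq> 0" "real k + 2 \<noteq> 0" "real j + real k + 2 \<noteq> 0"
    using jk by auto
  then have "a2 * b1 - a1 * b2 = 0"
    using z(3) unfolding trin_moment_zero_mean[OF a b] by simp
  with a b show "a0 + a1 / (real j + 1) + a2 / (real k + 1) = 0 \<and>
      b0 + b1 / (real j + 1) + b2 / (real k + 1) = 0 \<and> a2 * b1 - a1 * b2 = 0" by blast
next
  interpret abel "trin j k a0 a1 a2" "trin j k b0 b1 b2" by (rule abel_trin)
  define P Q where "P = 1 / (real j + 1)" and "Q = 1 / (real k + 1)"
  assume h: "a0 + a1 / (real j + 1) + a2 / (real k + 1) = 0 \<and>
      b0 + b1 / (real j + 1) + b2 / (real k + 1) = 0 \<and> a2 * b1 - a1 * b2 = 0"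
  then have 0: "a0 = - (a1 * P) - a2 * Q" "b0 = - (b1 * P) - b2 * Q"
    unfolding P_def Q_def by (simp_all add: algebra_simps)
  have d: "a2 * b1 - a1 * b2 = 0" using h by blast
  \<comment> \<open>Under the zero-mean conditions the other two minors are multiples of the first,
    so all three vanish.\<close>
  have "a0 * b2 - a2 * b0 = (a2 * b1 - a1 * b2) * P" "a1 * b0 - a0 * b1 = (a2 * b1 - a1 * b2) * Q"
    unfolding 0 by (simp_all add: algebra_simps)
  then have "a0 * b2 - a2 * b0 = 0" "a1 * b0 - a0 * b1 = 0" using d by simp_all
  from proportional_coefficients[OF d this]
  obtain a b c0 c1 c2 where c: "a = 1 \<or> a = 0 \<and> b = 1"
    "a0 = a * c0" "a1 = a * c1" "a2 = a * c2" "b0 = b * c0" "b1 = b * c1" "b2 = b * c2" .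
  have "integral {0..1} (trin j k c0 c1 c2) = 0"
    using h c unfolding trin_integral by auto
  moreover have "trin j k a0 a1 a2 = (\<lambda>t. a * trin j k c0 c1 c2 t)"
    "trin j k b0 b1 b2 = (\<lambda>t. b * trin j k c0 c1 c2 t)"
    unfolding c by (rule trin_scale)+
  ultimately show "has_center (trin j k a0 a1 a2) (trin j k b0 b1 b2) 0"
    using separable_center[OF trin_cont] by blast
qed

section \<open>Trinomial combinations without zeros in (0,1), and part (b)\<close>

lemma no_root_in_unit_interval:
  fixes D E :: real
  assumes "D \<noteq> 0" "E / D \<notin> {-1<..<0}" "0 < n" "0 < t" "t < 1"
  shows "E + D * t ^ n \<noteq> 0"
proof
  assume "E + D * t ^ n = 0"
  then have "E / D = - (t ^ n)" using assms(1) by (simp add: field_simps add_eq_0_iff)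
  moreover have "0 < t ^ n" "t ^ n < 1" using assms by (simp_all add: power_less_one_iff)
  ultimately show False using assms(2) by simp
qed

lemma trin_combination_nonzero:
  assumes jk: "0 < j" "j < k"
    and cond: "(a2 * b1 - a1 * b2 = 0 \<or> (a2 * b0 - a0 * b2) / (a2 * b1 - a1 * b2) \<notin> {-1<..<0}) \<or>
           (a1 * b2 - a2 * b1 = 0 \<or> (a1 * b0 - a0 * b1) / (a1 * b2 - a2 * b1) \<notin> {-1<..<0}) \<or>
           (a0 * b2 - a2 * b0 = 0 \<or> (a0 * b1 - a1 * b0) / (a0 * b2 - a2 * b0) \<notin> {-1<..<0})"
    and ne: "\<not> (a2 * b1 - a1 * b2 = 0 \<and> a0 * b2 - a2 * b0 = 0 \<and> a1 * b0 - a0 * b1 = 0)"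
  obtains \<alpha> \<beta> where "\<And>t. 0 < t \<Longrightarrow> t < 1 \<Longrightarrow> \<alpha> * trin j k a0 a1 a2 t + \<beta> * trin j k b0 b1 b2 t \<noteq> 0"
proof -
  define D12 D02 D01 where D: "D12 = a2 * b1 - a1 * b2" "D02 = a2 * b0 - a0 * b2" "D01 = a1 * b0 - a0 * b1"
  \<comment> \<open>The combinations below eliminate \<open>t ^ k\<close>, \<open>t ^ j\<close> and
    the constant term in turn; their coefficients are the minors, whose quotients occur in the three
    conditions.\<close>
  have id2: "- b2 * trin j k a0 a1 a2 t + a2 * trin j k b0 b1 b2 t = D02 + D12 * t ^ j" for t
    by (simp add: trin_def D algebra_simps)
  have id1: "- b1 * trin j k a0 a1 a2 t + a1 * trin j k b0 b1 b2 t = D01 + (- D12) * t ^ k" for t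
    by (simp add: trin_def D algebra_simps)
  have id0: "- b0 * trin j k a0 a1 a2 t + a0 * trin j k b0 b1 b2 t = t ^ j * ((- D01) + (- D02) * t ^ (k - j))" for t
  proof -
    have "t ^ k = t ^ j * t ^ (k - j)" using jk by (simp flip: power_add)
    then show ?thesis by (simp add: trin_def D algebra_simps)
  qed
  \<comment> \<open>If the denominator of a condition vanishes, some combination is a nonzero
    constant or a nonzero multiple of \<open>t ^ j\<close>, unless another quotient is 0 and so lies
    outside (-1,0).\<close>
  consider "D12 = 0" "D02 \<noteq> 0" | "D12 = 0" "D02 = 0" "D01 \<noteq> 0" | "D12 \<noteq> 0" "D02 / D12 \<notin> {-1<..<0}"
    | "D12 \<noteq> 0" "D01 / (- D12) \<notin> {-1<..<0}" | "D12 \<noteq> 0" "D02 = 0" "D01 \<noteq> 0"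
    | "D02 \<noteq> 0" "(- D01) / (- D02) \<notin> {-1<..<0}"
    using cond ne unfolding D by (smt (verit) minus_diff_eq divide_eq_0_iff greaterThanLessThan_iff)
  then show ?thesis
  proof cases
    case 1
    show ?thesis by (rule that[of "- b2" a2], unfold id2) (use 1 in simp)
  next
    case 2
    show ?thesis by (rule that[of "- b1" a1], unfold id1) (use 2 in simp)
  next
    case 3
    show ?thesis by (rule that[of "- b2" a2], unfold id2) (rule no_root_in_unit_interval[OF 3 jk(1)])
  next
    case 4
    show ?thesis by (rule that[of "- b1" a1], unfold id1) (rule no_root_in_unit_interval, use 4 jk in auto)
  next
    case 5
    show ?thesis by (rule that[of "- b0" a0], unfold id0) (use 5 in simp)
  next
    case 6
    show ?thesis
    proof (rule that[of "- b0" a0], unfold id0)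
      fix t :: real assume t: "0 < t" "t < 1"
      have "(- D01) + (- D02) * t ^ (k - j) \<noteq> 0"
        by (rule no_root_in_unit_interval) (use 6 jk t in auto)
      then show "t ^ j * ((- D01) + (- D02) * t ^ (k - j)) \<noteq> 0" using t by simp
    qed
  qed
qed

text \<open>If all minors vanish, the equation is separable and the absence of a center gives the
  common factor a nonzero mean. Otherwise a combination without zeros exists.\<close>

lemma trin_at_most_one:
  assumes jk: "0 < j" "j < k"
    and nc: "\<not> has_center (trin j k a0 a1 a2) (trin j k b0 b1 b2) 0"
    and cond: "(a2 * b1 - a1 * b2 = 0 \<or> (a2 * b0 - a0 * b2) / (a2 * b1 - a1 * b2) \<notin> {-1<..<0}) \<or>
           (a1 * b2 - a2 * b1 = 0 \<or> (a1 * b0 - a0 * b1) / (a1 * b2 - a2 * b1) \<notin> {-1<..<0}) \<or>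
           (a0 * b2 - a2 * b0 = 0 \<or> (a0 * b1 - a1 * b0) / (a0 * b2 - a2 * b0) \<notin> {-1<..<0})"
  defines "A \<equiv> trin j k a0 a1 a2" and "B \<equiv> trin j k b0 b1 b2"
  shows "(\<forall>x y. x \<noteq> 0 \<and> y \<noteq> 0 \<and> periodic_orbit A B x \<and> periodic_orbit A B y \<longrightarrow> x = y) \<and>
         (\<forall>x. x \<noteq> 0 \<and> periodic_orbit A B x \<longrightarrow> hyperbolic_orbit A B x)"
proof -
  interpret abel A B unfolding A_def B_def by (rule abel_trin)
  show ?thesis
  proof (cases "a2 * b1 - a1 * b2 = 0 \<and> a0 * b2 - a2 * b0 = 0 \<and> a1 * b0 - a0 * b1 = 0")
    case True
    then have "a2 * b1 - a1 * b2 = 0" "a0 * b2 - a2 * b0 = 0" "a1 * b0 - a0 * b1 = 0" by blast+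
    from proportional_coefficients[OF this]
    obtain a b c0 c1 c2 where c: "a = 1 \<or> a = 0 \<and> b = 1"
      "a0 = a * c0" "a1 = a * c1" "a2 = a * c2" "b0 = b * c0" "b1 = b * c1" "b2 = b * c2" .
    have AB: "A = (\<lambda>t. a * trin j k c0 c1 c2 t)" "B = (\<lambda>t. b * trin j k c0 c1 c2 t)"
      unfolding A_def B_def c by (rule trin_scale)+
    have int: "integral {0..1} (trin j k c0 c1 c2) \<noteq> 0"
      using separable_center[OF trin_cont _ AB] nc unfolding A_def B_def by blast
    have "a \<noteq> 0 \<or> b \<noteq> 0" using c(1) by auto
    from separable_periodic[OF trin_cont int AB this] show ?thesis by blast
  next
    case False
    from trin_combination_nonzero[OF jk cond False]
    obtain \<alpha> \<beta> where "\<And>t. 0 < t \<Longrightarrow> t < 1 \<Longrightarrow> \<alpha> * A t + \<beta> * B t \<noteq> 0"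
      unfolding A_def B_def by blast
    from combination_nonzero[OF this] show ?thesis by blast
  qed
qed

subsection \<open>Two hyperbolic orbits\<close>

text \<open>
  With \<open>A\<^sub>0 = t - 1/2\<close> and \<open>B\<^sub>0 = t\<^sup>2 - 1/3\<close> the third integral is \<open>c = - 1/360\<close>. Adding the constants
  \<open>- 4 c h\<close> to \<open>A\<^sub>0\<close> and \<open>3 c h\<^sup>2\<close> to \<open>B\<^sub>0\<close> makes the quadratic close to \<open>c (x - h) (x - 3 h)\<close>. Here
  \<open>h = 1/1000000\<close>, and the orbits are found in \<open>[h/2, 3h/2]\<close> and \<open>[5h/2, 4h]\<close>.
\<close>

definition example_A :: "real \<Rightarrow> real" where
  "example_A = trin 1 2 (1 / 90000000 - 1 / 2) 1 0"

definition example_B :: "real \<Rightarrow> real" where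
  "example_B = trin 1 2 (- 1 / 120000000000000 - 1 / 3) 0 1"

text \<open>The value of \<open>trin_moment\<close> for the perturbed coefficients, hence only close
  to - 1/360.\<close>

definition example_moment :: real where
  "example_moment = (1 / 90000000 - 1 / 2) * ((- 1 / 120000000000000 - 1 / 3) / 2 + 1 / 12)
     + (- 1 / 120000000000000 - 1 / 3) / 3 + 1 / 15"

interpretation example: abel example_A example_B
  unfolding example_A_def example_B_def by (rule abel_trin)

text \<open>Both expansions with \<open>M = 1\<close>. Positivity of \<open>u 1\<close> is included
  so that reciprocals can be compared.\<close>

lemma example_small_solution:
  assumes x: "0 < x" "x \<le> 1 / 16"
  obtains u where "abel_sol example_A example_B x u" "0 < u 1"
    "\<bar>(1 / x - 1 / u 1) - (- 1 / 120000000000000 + x * (1 / 90000000) + x^2 * example_moment)\<bar> \<le> 10 * x^3"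
    "\<bar>integral {0..1} (\<lambda>t. example_A t * (u t)^2) - (x^2 * (1 / 90000000) + 2 * x^3 * example_moment)\<bar>
      \<le> 36 * x^4"
proof -
  have bA: "\<bar>example_A t\<bar> \<le> 1" if "t \<in> {0..1}" for t
    using that by (simp add: example_A_def trin_def abs_le_iff)
  have bB: "\<bar>example_B t\<bar> \<le> 1" if "t \<in> {0..1}" for t
  proof -
    have "0 \<le> t^2" "t^2 \<le> 1" using that by (simp_all add: power_le_one)
    then show ?thesis unfolding example_B_def trin_def by linarith
  qed
  obtain u where u: "abel_sol example_A example_B x u"
    by (rule example.small_solution_exists[of 1 x, OF order_refl bA bB]) (use x in auto)
  interpret abel_small example_A example_B 1 x u "trin_prim 1 2 (- 1 / 120000000000000 - 1 / 3) 0 1"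
    by unfold_locales
      (use x u bA bB in \<open>auto simp: example_B_def intro: trin_prim_deriv\<close>)
  have intA: "integral {0..1} example_A = 1 / 90000000"
    unfolding example_A_def trin_integral by simp
  have moment: "integral {0..1} (\<lambda>t. example_A t * trin_prim 1 2 (- 1 / 120000000000000 - 1 / 3) 0 1 t)
      = example_moment"
    unfolding example_A_def trin_moment example_moment_def by simp
  show ?thesis
  proof (rule that[OF u])
    have "\<bar>u 1 - x\<bar> \<le> 4 * 1 * x^2" by (rule expansion_first) simp
    moreover have "4 * x^2 < x" using x by (simp add: power2_eq_square)
    ultimately show "0 < u 1" by linarith
    show "\<bar>(1 / x - 1 / u 1) - (- 1 / 120000000000000 + x * (1 / 90000000) + x^2 * example_moment)\<bar> \<le> 10 * x^3"
      using displacement_expansion x unfolding intA moment by (simp add: trin_prim_1)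
    show "\<bar>integral {0..1} (\<lambda>t. example_A t * (u t)^2) - (x^2 * (1 / 90000000) + 2 * x^3 * example_moment)\<bar>
      \<le> 36 * x^4"
      using square_expansion unfolding intA moment by simp
  qed
qed

text \<open>Once the quadratic exceeds the cubic error term, 1/x - 1/P(x) is positive.\<close>

lemma example_above:
  assumes "0 < x" "x \<le> 1 / 16"
    and "10 * x^3 < - 1 / 120000000000000 + x * (1 / 90000000) + x^2 * example_moment"
  shows "x < poincare example_A example_B x"
proof -
  obtain u where u: "abel_sol example_A example_B x u" "0 < u 1"
    "\<bar>(1 / x - 1 / u 1) - (- 1 / 120000000000000 + x * (1 / 90000000) + x^2 * example_moment)\<bar> \<le> 10 * x^3"
    by (rule example_small_solution[OF assms(1,2)]) blast
  have "1 / u 1 < 1 / x" using u(3) assms(3) by linarith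
  then have "x < u 1" using assms(1) u(2) by (simp add: field_simps)
  then show ?thesis by (simp add: example.poincare_eq[OF u(1)])
qed

lemma example_below:
  assumes "0 < x" "x \<le> 1 / 16"
    and "- 1 / 120000000000000 + x * (1 / 90000000) + x^2 * example_moment < - 10 * x^3"
  shows "poincare example_A example_B x < x"
proof -
  obtain u where u: "abel_sol example_A example_B x u" "0 < u 1"
    "\<bar>(1 / x - 1 / u 1) - (- 1 / 120000000000000 + x * (1 / 90000000) + x^2 * example_moment)\<bar> \<le> 10 * x^3"
    by (rule example_small_solution[OF assms(1,2)]) blast
  have "1 / x < 1 / u 1" using u(3) assms(3) by linarith
  then have "u 1 < x" using assms(1) u(2) by (simp add: field_simps)
  then show ?thesis by (simp add: example.poincare_eq[OF u(1)])
qed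

text \<open>The exponent splits as 2 (A u^2 + B u) + A u^2, whose first part integrates to 0 on a
  periodic orbit. The second has nonzero integral by \<open>square_expansion\<close>, with
  \<open>nz\<close> multiplied by x^2.\<close>

lemma example_hyperbolic:
  assumes x: "0 < x" "x \<le> 1 / 16" and fixed: "poincare example_A example_B x = x"
    and nz: "36 * x^2 < \<bar>1 / 90000000 + 2 * x * example_moment\<bar>"
  shows "hyperbolic_orbit example_A example_B x"
proof -
  obtain u where u: "abel_sol example_A example_B x u"
    "\<bar>integral {0..1} (\<lambda>t. example_A t * (u t)^2) - (x^2 * (1 / 90000000) + 2 * x^3 * example_moment)\<bar>
      \<le> 36 * x^4"
    by (rule example_small_solution[OF x]) blast
  have u1: "u 1 = x" using fixed example.poincare_eq[OF u(1)] by simp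
  have x0: "x \<noteq> 0" using x by simp
  have "36 * x^4 = x^2 * (36 * x^2)" by (simp add: power4_eq_xxxx power2_eq_square)
  also have "\<dots> < x^2 * \<bar>1 / 90000000 + 2 * x * example_moment\<bar>"
    using nz x by (intro mult_strict_left_mono) auto
  also have "\<dots> = \<bar>x^2 * (1 / 90000000 + 2 * x * example_moment)\<bar>" by (simp add: abs_mult)
  also have "x^2 * (1 / 90000000 + 2 * x * example_moment) = x^2 * (1 / 90000000) + 2 * x^3 * example_moment"
    by (simp add: power2_eq_square power3_eq_cube algebra_simps)
  finally have int: "integral {0..1} (\<lambda>t. example_A t * (u t)^2) \<noteq> 0" using u(2) by linarith
  have "((\<lambda>t. example_A t * (u t)^2 + example_B t * u t) has_integral 0) {0..1}"
    using integral_derivative[OF example.log_deriv[OF u(1) x0], of 1] u1 example.sol_init[OF u(1)] by simp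
  moreover have "((\<lambda>t. example_A t * (u t)^2) has_integral integral {0..1} (\<lambda>t. example_A t * (u t)^2)) {0..1}"
    by (intro integrable_integral integrable_continuous_real continuous_intros
        example.contA example.sol_cont[OF u(1)])
  ultimately have "((\<lambda>t. 2 * (example_A t * (u t)^2 + example_B t * u t) + example_A t * (u t)^2) has_integral
      2 * 0 + integral {0..1} (\<lambda>t. example_A t * (u t)^2)) {0..1}"
    by (intro has_integral_add has_integral_mult_right)
  moreover have "(\<lambda>t. 2 * (example_A t * (u t)^2 + example_B t * u t) + example_A t * (u t)^2)
      = (\<lambda>t. 3 * example_A t * (u t)^2 + 2 * example_B t * u t)"
    by (simp add: algebra_simps)
  ultimately show ?thesis
    using example.hyperbolicI[OF u(1) u1] int by (simp add: integral_unique)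
qed

lemma example_two_hyperbolic_orbits:
  "\<exists>x y. x \<noteq> 0 \<and> y \<noteq> 0 \<and> x \<noteq> y \<and> hyperbolic_orbit example_A example_B x \<and> hyperbolic_orbit example_A example_B y"
proof -
  let ?P = "poincare example_A example_B"
  have m: "- 1 / 360 - 1 / 1000000 \<le> example_moment" "example_moment \<le> - 1 / 360 + 1 / 1000000"
    by (simp_all add: example_moment_def)
  have cont: "continuous_on {a..b} (\<lambda>x. ?P x - x)" if "0 < a" "b \<le> 1 / 16" for a b
  proof -
    have "{a..b} \<subseteq> abel_dom example_A example_B"
    proof
      fix x assume "x \<in> {a..b}"
      then have "0 < x" "x \<le> 1 / 16" using that by auto
      from example_small_solution[OF this] show "x \<in> abel_dom example_A example_B"
        unfolding abel_dom_def by blast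
    qed
    then show ?thesis
      by (intro continuous_intros continuous_on_subset[OF example.poincare_cont])
  qed
  \<comment> \<open>With c < 0 the quadratic c (x - h) (x - 3 h) is positive exactly between its
    roots; the four points h/2, 3h/2, 5h/2, 4h show the sign changes.\<close>
  have s1: "?P (1 / 2000000) < 1 / 2000000"
    by (rule example_below) (use m in \<open>simp_all add: power2_eq_square power3_eq_cube\<close>)
  have s2: "3 / 2000000 < ?P (3 / 2000000)"
    by (rule example_above) (use m in \<open>simp_all add: power2_eq_square power3_eq_cube\<close>)
  have s3: "5 / 2000000 < ?P (5 / 2000000)"
    by (rule example_above) (use m in \<open>simp_all add: power2_eq_square power3_eq_cube\<close>)
  have s4: "?P (4 / 1000000) < 4 / 1000000"
    by (rule example_below) (use m in \<open>simp_all add: power2_eq_square power3_eq_cube\<close>)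
  obtain x where x: "1 / 2000000 \<le> x" "x \<le> 3 / 2000000" "?P x - x = 0"
    using IVT'[of "\<lambda>x. ?P x - x" "1 / 2000000" 0 "3 / 2000000", OF _ _ _ cont] s1 s2 by force
  obtain y where y: "5 / 2000000 \<le> y" "y \<le> 4 / 1000000" "?P y - y = 0"
    using IVT2'[of "\<lambda>x. ?P x - x" "4 / 1000000" 0 "5 / 2000000", OF _ _ _ cont] s3 s4 by force
  have "hyperbolic_orbit example_A example_B x"
  proof (rule example_hyperbolic)
    \<comment> \<open>The derivative of the quadratic is close to 2 c (x - 2 h): positive for x up
      to 3h/2 and, for the second orbit, negative from 5h/2 on.\<close>
    have "x * (- 1 / 360 - 1 / 1000000) \<le> x * example_moment"
      using m x by (intro mult_left_mono) auto
    then have "1 / 1000000000 < 1 / 90000000 + 2 * x * example_moment"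
      using x by simp
    moreover have "x^2 \<le> 9 / 4000000000000" using power_mono[of x "3 / 2000000" 2] x by (simp add: power2_eq_square)
    ultimately show "36 * x^2 < \<bar>1 / 90000000 + 2 * x * example_moment\<bar>"
      using x by linarith
  qed (use x in auto)
  moreover have "hyperbolic_orbit example_A example_B y"
  proof (rule example_hyperbolic)
    have "y * example_moment \<le> y * (- 1 / 360 + 1 / 1000000)"
      using m y by (intro mult_left_mono) auto
    then have "1 / 90000000 + 2 * y * example_moment < - 1 / 1000000000"
      using y by simp
    moreover have "y^2 \<le> 16 / 1000000000000" using power_mono[of y "4 / 1000000" 2] y by (simp add: power2_eq_square)
    ultimately show "36 * y^2 < \<bar>1 / 90000000 + 2 * y * example_moment\<bar>"
      using y by linarith
  qed (use y in auto)
  ultimately show ?thesis using x(1,2) y(1,2) by (intro exI[of _ x] exI[of _ y]) auto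
qed

theorem theoremC:
  shows "(\<forall>(j::nat) (k::nat) (a0::real) a1 a2 (b0::real) b1 b2.
      0 < j \<and> j < k \<longrightarrow>
      (let A = trin j k a0 a1 a2; B = trin j k b0 b1 b2 in
        (has_center A B 0 \<longleftrightarrow>
           (a0 + a1 / (real j + 1) + a2 / (real k + 1) = 0 \<and>
            b0 + b1 / (real j + 1) + b2 / (real k + 1) = 0 \<and>
            a2 * b1 - a1 * b2 = 0)) \<and>
        ((\<not> has_center A B 0 \<and>
          ((a2 * b1 - a1 * b2 = 0 \<or> (a2 * b0 - a0 * b2) / (a2 * b1 - a1 * b2) \<notin> {-1<..<0}) \<or>
           (a1 * b2 - a2 * b1 = 0 \<or> (a1 * b0 - a0 * b1) / (a1 * b2 - a2 * b1) \<notin> {-1<..<0}) \<or>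
           (a0 * b2 - a2 * b0 = 0 \<or> (a0 * b1 - a1 * b0) / (a0 * b2 - a2 * b0) \<notin> {-1<..<0})))
         \<longrightarrow>
          (\<forall>x y. x \<noteq> 0 \<and> y \<noteq> 0 \<and> periodic_orbit A B x \<and> periodic_orbit A B y \<longrightarrow> x = y) \<and>
          (\<forall>x. x \<noteq> 0 \<and> periodic_orbit A B x \<longrightarrow> hyperbolic_orbit A B x))))
   \<and>
   (\<exists>(j::nat) (k::nat) (a0::real) a1 a2 (b0::real) b1 b2 x y.
      0 < j \<and> j < k \<and> x \<noteq> 0 \<and> y \<noteq> 0 \<and> x \<noteq> y \<and>
      hyperbolic_orbit (trin j k a0 a1 a2) (trin j k b0 b1 b2) x \<and>
      hyperbolic_orbit (trin j k a0 a1 a2) (trin j k b0 b1 b2) y)"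
proof (rule conjI)
  show "\<exists>(j::nat) (k::nat) (a0::real) a1 a2 (b0::real) b1 b2 x y.
      0 < j \<and> j < k \<and> x \<noteq> 0 \<and> y \<noteq> 0 \<and> x \<noteq> y \<and>
      hyperbolic_orbit (trin j k a0 a1 a2) (trin j k b0 b1 b2) x \<and>
      hyperbolic_orbit (trin j k a0 a1 a2) (trin j k b0 b1 b2) y"
  proof -
    have "(0::nat) < 1" "(1::nat) < 2" by simp_all
    with example_two_hyperbolic_orbits show ?thesis
      unfolding example_A_def example_B_def by blast
  qed
qed (simp only: Let_def, intro allI impI conjI trin_center_iff trin_at_most_one; blast)

end
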